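(* Let $K\ge1$, $s\ge0$, $1\le R_1,R_2\le K$, and let $\Delta=(\mathbf w,\mathcal R_1,\phi)$ be an admissible substructure. Then the number of arrowed arrays in $\mathrm{AR}(K,R_1,R_2,s)$ belonging to $\Delta$ is \[ T(\Delta)=r\sum_{A=0}^{\min(s,K)-1}\frac{M!\,(K-A-1)!\,(s-A-1)!}{(M-A)!\,(K-R_2-A)!\,(R_2-1)!}, \] where $r=\sum_{j\in\mathcal R_1}w_j$ and $M$ is the number of columns containing a critical vertex in row 1.
   Context: Two-row vertical arrays: for $K\ge1$, $s\ge0$, $1\le R_1,R_2\le K$, such an array is a $2\times K$ grid of cells, each cell containing a possibly empty left-to-right ordered list of unlabelled vertices, each row containing $s$ vertices, the vertices partitioned into $s$ pairs each consisting of one vertex of row 1 and one of row 2 (partners), with exactly $R_1$ marked cells in row 1 and $R_2$ in row 2. Arrays are equal if they have the same vertex counts per cell, marked cells and pairing of vertex positions. Arrowed array: a pair $(\alpha,\phi)$ where $\alpha$ is such an array and $\phi$ is a function from a subset $\mathcal H\subseteq\{1,\dots,K\}\setminus\mathcal R_1$ to $\{1,\dots,K\}$, $\mathcal R_1$ being the set of marked columns of row 1. A vertex is critical if it is the rightmost vertex of its cell and that cell is neither marked nor a row-1 cell $(1,j)$ with $j\in\mathcal H$. Forest condition: let $\mathcal F_i$ be the set of columns whose row-$i$ cell is nonempty and $\mathcal R_2$ the marked columns of row 2; define $\psi_1$ on $(\mathcal H\cup\mathcal F_1)\setminus\mathcal R_1$ by $\psi_1(j)=\phi(j)$ for $j\in\mathcal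 H$ and, for $j\in\mathcal F_1\setminus(\mathcal H\cup\mathcal R_1)$, $\psi_1(j)=$ the column of the partner of the rightmost vertex of cell $(1,j)$; define $\psi_2$ on $\mathcal F_2\setminus\mathcal R_2$ by $\psi_2(j)=$ the column of the partner of the rightmost vertex of cell $(2,j)$. The forest condition holds if for $i=1,2$ every $j$ in the domain of $\psi_i$ has some $t\ge1$ with $\psi_i^t(j)$ defined and in $\mathcal R_i$. $\mathrm{AR}(K,R_1,R_2,s)$ is the set of arrowed arrays satisfying the forest condition. Substructure $\Delta$: given $\mathbf w=(w_1,\dots,w_K)$ non-negative integers with $\sum_jw_j=s$, an $R_1$-subset $\mathcal R_1$ of columns, and $\phi$ a function from $\mathcal H\subseteq\{1,\dots,K\}\setminus\mathcal R_1$ to $\{1,\dots,K\}$, $\Delta=(\mathbf w,\mathcal R_1,\phi)$ is the set of $(\alpha,\phi')\in\mathrm{AR}(K,R_1,R_2,s)$ with $\phi'=\phi$, row-1 marked set $\mathcal R_1$, and both cells $(1,j),(2,j)$ containing exactly $w_j$ vertices for every $j$ (so each member satisfies the balance condition: equal vertex counts in the two cells of every column); $T(\Delta)$ is its cardinality. $\Delta$ is irreducible if the functional digraph of $\phi$ is acyclic and $\phi(j)\notin\mathcal R_1\cup\mathcal H$ for all $j\in\mathcal H$; admissible if irreducible and $w_{\phi(j)}\ge1$ for every $j\in\mathcal H$. Any term with the factorial of a negative integer in its denominator is $0$.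
   Formalization: The formal statement assumes s ≥ 1 instead of s ≥ 0: for s = 0 the formula gives 0 (r = 0, empty sum), whereas the forest condition holds vacuously and T(Δ) = binom(K, R_2) ≥ 1. *)

theory Defs
  imports Complex_Main "HOL-Library.Disjoint_Sets"
begin

datatype row = Row1 | Row2

text \<open>
  A vertex is addressed as (row, column, position): columns are \<open>1..K\<close>, and positions in a
  cell are counted from the left starting at \<open>1\<close>. The vertices being unlabelled, an array is given
  exactly by the data that decide equality of arrays: cell counts, marked columns of each row,
  and the set of pairs of vertex positions.
\<close>

type_synonym vertex = "row \<times> nat \<times> nat"

record varray =
  cnt :: "row \<Rightarrow> nat \<Rightarrow> nat"
  marked :: "row \<Rightarrow> nat set"
  pairing :: "vertex set set"

definition row_vertices :: "varray \<Rightarrow> row \<Rightarrow> vertex set" where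
  "row_vertices \<alpha> i = {(i, j, p) | j p. 1 \<le> p \<and> p \<le> cnt \<alpha> i j}"

text \<open>Counts vanish outside the \<open>K\<close> columns, so that each array has only one representation.\<close>

definition two_row_array :: "nat \<Rightarrow> nat \<Rightarrow> nat \<Rightarrow> nat \<Rightarrow> varray \<Rightarrow> bool" where
  "two_row_array K R1 R2 s \<alpha> \<longleftrightarrow>
     (\<forall>i j. j \<notin> {1..K} \<longrightarrow> cnt \<alpha> i j = 0) \<and>
     (\<forall>i. (\<Sum>j\<in>{1..K}. cnt \<alpha> i j) = s) \<and>
     (\<forall>i. marked \<alpha> i \<subseteq> {1..K}) \<and>
     card (marked \<alpha> Row1) = R1 \<and> card (marked \<alpha> Row2) = R2 \<and>
     partition_on (row_vertices \<alpha> Row1 \<union> row_vertices \<alpha> Row2) (pairing \<alpha>) \<and>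
     (\<forall>B\<in>pairing \<alpha>. \<exists>u\<in>row_vertices \<alpha> Row1. \<exists>v\<in>row_vertices \<alpha> Row2. B = {u, v})"

definition partner :: "varray \<Rightarrow> vertex \<Rightarrow> vertex" where
  "partner \<alpha> v = (THE u. u \<noteq> v \<and> {v, u} \<in> pairing \<alpha>)"

definition vcol :: "vertex \<Rightarrow> nat" where
  "vcol v = fst (snd v)"

text \<open>
  The arrow function \<open>\<phi>\<close> is a partial map; the set \<open>\<H>\<close> of columns with an arrow is \<open>dom \<phi>\<close>.
\<close>

definition arrow_fun :: "nat \<Rightarrow> nat set \<Rightarrow> (nat \<rightharpoonup> nat) \<Rightarrow> bool" where
  "arrow_fun K \<R>\<^sub>1 \<phi> \<longleftrightarrow> dom \<phi> \<subseteq> {1..K} - \<R>\<^sub>1 \<and> ran \<phi> \<subseteq> {1..K}"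

text \<open>The functions \<open>\<psi>\<^sub>1\<close> and \<open>\<psi>\<^sub>2\<close>, as partial maps.\<close>

definition psi :: "varray \<Rightarrow> (nat \<rightharpoonup> nat) \<Rightarrow> row \<Rightarrow> nat \<rightharpoonup> nat" where
  "psi \<alpha> \<phi> i j =
     (if j \<in> marked \<alpha> i then None
      else if i = Row1 \<and> j \<in> dom \<phi> then \<phi> j
      else if cnt \<alpha> i j > 0 then Some (vcol (partner \<alpha> (i, j, cnt \<alpha> i j)))
      else None)"

definition forest_condition :: "varray \<Rightarrow> (nat \<rightharpoonup> nat) \<Rightarrow> bool" where
  "forest_condition \<alpha> \<phi> \<longleftrightarrow>
     (\<forall>i. \<forall>j\<in>dom (psi \<alpha> \<phi> i). \<exists>t\<ge>1. \<exists>k\<in>marked \<alpha> i. (j, k) \<in> Map.graph (psi \<alpha> \<phi> i) ^^ t)"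

definition AR :: "nat \<Rightarrow> nat \<Rightarrow> nat \<Rightarrow> nat \<Rightarrow> (varray \<times> (nat \<rightharpoonup> nat)) set" where
  "AR K R1 R2 s =
     {(\<alpha>, \<phi>). two_row_array K R1 R2 s \<alpha> \<and> arrow_fun K (marked \<alpha> Row1) \<phi> \<and>
             forest_condition \<alpha> \<phi>}"

text \<open>
  Critical vertices depend on the array only through its cell counts \<open>c\<close> and marked columns \<open>\<R>\<close>.
\<close>

fun critical :: "(row \<Rightarrow> nat \<Rightarrow> nat) \<Rightarrow> (row \<Rightarrow> nat set) \<Rightarrow> (nat \<rightharpoonup> nat) \<Rightarrow> vertex \<Rightarrow> bool" where
  "critical c \<R> \<phi> (i, j, p) \<longleftrightarrow>
     1 \<le> p \<and> p = c i j \<and> j \<notin> \<R> i \<and> \<not> (i = Row1 \<and> j \<in> dom \<phi>)"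

definition substructure ::
    "nat \<Rightarrow> nat \<Rightarrow> nat \<Rightarrow> (nat \<Rightarrow> nat) \<Rightarrow> nat set \<Rightarrow> (nat \<rightharpoonup> nat) \<Rightarrow> bool" where
  "substructure K R1 s w \<R>\<^sub>1 \<phi> \<longleftrightarrow>
     (\<Sum>j\<in>{1..K}. w j) = s \<and> \<R>\<^sub>1 \<subseteq> {1..K} \<and> card \<R>\<^sub>1 = R1 \<and> arrow_fun K \<R>\<^sub>1 \<phi>"

definition \<Delta> ::
    "nat \<Rightarrow> nat \<Rightarrow> nat \<Rightarrow> nat \<Rightarrow> (nat \<Rightarrow> nat) \<Rightarrow> nat set \<Rightarrow> (nat \<rightharpoonup> nat)
     \<Rightarrow> (varray \<times> (nat \<rightharpoonup> nat)) set" where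
  "\<Delta> K R1 R2 s w \<R>\<^sub>1 \<phi> =
     {(\<alpha>, \<phi>') \<in> AR K R1 R2 s. \<phi>' = \<phi> \<and> marked \<alpha> Row1 = \<R>\<^sub>1 \<and>
        (\<forall>j\<in>{1..K}. cnt \<alpha> Row1 j = w j \<and> cnt \<alpha> Row2 j = w j)}"

definition T ::
    "nat \<Rightarrow> nat \<Rightarrow> nat \<Rightarrow> nat \<Rightarrow> (nat \<Rightarrow> nat) \<Rightarrow> nat set \<Rightarrow> (nat \<rightharpoonup> nat) \<Rightarrow> nat" where
  "T K R1 R2 s w \<R>\<^sub>1 \<phi> = card (\<Delta> K R1 R2 s w \<R>\<^sub>1 \<phi>)"

definition irreducible_arrows :: "nat set \<Rightarrow> (nat \<rightharpoonup> nat) \<Rightarrow> bool" where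
  "irreducible_arrows \<R>\<^sub>1 \<phi> \<longleftrightarrow>
     acyclic (Map.graph \<phi>) \<and> (\<forall>j\<in>dom \<phi>. the (\<phi> j) \<notin> \<R>\<^sub>1 \<union> dom \<phi>)"

definition admissible ::
    "nat \<Rightarrow> nat \<Rightarrow> nat \<Rightarrow> (nat \<Rightarrow> nat) \<Rightarrow> nat set \<Rightarrow> (nat \<rightharpoonup> nat) \<Rightarrow> bool" where
  "admissible K R1 s w \<R>\<^sub>1 \<phi> \<longleftrightarrow>
     substructure K R1 s w \<R>\<^sub>1 \<phi> \<and> irreducible_arrows \<R>\<^sub>1 \<phi> \<and>
     (\<forall>j\<in>dom \<phi>. w (the (\<phi> j)) \<ge> 1)"

text \<open>
  The number \<open>M\<close> of columns containing a critical vertex in row 1, read off from the data of a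
  substructure. Only row 1 is inspected, so the marked columns supplied for row 2 are irrelevant;
  lemma \<open>num_critical_member\<close> shows that every member of the substructure has this number.
\<close>

definition num_critical :: "nat \<Rightarrow> (nat \<Rightarrow> nat) \<Rightarrow> nat set \<Rightarrow> (nat \<rightharpoonup> nat) \<Rightarrow> nat" where
  "num_critical K w \<R>\<^sub>1 \<phi> =
     card {j\<in>{1..K}. \<exists>p. critical (\<lambda>_. w) (case_row \<R>\<^sub>1 {}) \<phi> (Row1, j, p)}"

lemma num_critical_member:
  assumes "(\<alpha>, \<phi>') \<in> \<Delta> K R1 R2 s w \<R>\<^sub>1 \<phi>"
  shows "card {j\<in>{1..K}. \<exists>p. critical (cnt \<alpha>) (marked \<alpha>) \<phi>' (Row1, j, p)}
    = num_critical K w \<R>\<^sub>1 \<phi>"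
  using assms unfolding num_critical_def \<Delta>_def
  by (intro arg_cong[of _ _ card] Collect_cong) auto

text \<open>
  \<open>1/n!\<close>, with the convention that a term with the factorial of a negative integer in its
  denominator is \<open>0\<close>.
\<close>

definition inv_fact :: "int \<Rightarrow> real" where
  "inv_fact n = (if n < 0 then 0 else 1 / fact (nat n))"

text \<open>
  Arrays without vertices satisfy the forest condition vacuously, so for \<open>s = 0\<close> the count is a
  binomial coefficient, whereas the closed formula, with \<open>r = 0\<close> and an empty sum, would give \<open>0\<close>.
  The formula therefore needs \<open>s \<ge> 1\<close>.
\<close>

lemma T_no_vertices:
  assumes "\<R>\<^sub>1 \<subseteq> {1..K}" and "card \<R>\<^sub>1 = R1"
  shows "T K R1 R2 0 (\<lambda>_. 0) \<R>\<^sub>1 Map.empty = K choose R2"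
proof -
  define f :: "nat set \<Rightarrow> varray \<times> (nat \<rightharpoonup> nat)" where
    "f S = (\<lparr>cnt = \<lambda>_ _. 0, marked = case_row \<R>\<^sub>1 S, pairing = {}\<rparr>, Map.empty)" for S
  have "inj f"
    by (rule injI) (auto simp: f_def dest!: fun_cong[where x = Row2])
  have "\<Delta> K R1 R2 0 (\<lambda>_. 0) \<R>\<^sub>1 Map.empty = f ` {S. S \<subseteq> {1..K} \<and> card S = R2}" (is "?L = f ` ?S")
  proof (intro equalityI subsetI)
    fix x assume x: "x \<in> ?L"
    obtain \<alpha> \<phi> where x_def: "x = (\<alpha>, \<phi>)" by (cases x)
    have arr: "two_row_array K R1 R2 0 \<alpha>" and \<phi>: "\<phi> = Map.empty" and m1: "marked \<alpha> Row1 = \<R>\<^sub>1"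
      using x unfolding x_def \<Delta>_def AR_def by auto
    have c: "cnt \<alpha> = (\<lambda>_ _. 0)"
    proof (intro ext)
      fix i j
      show "cnt \<alpha> i j = 0"
        using arr unfolding two_row_array_def by (cases "j \<in> {1..K}") auto
    qed
    have m2: "marked \<alpha> Row2 \<in> ?S"
      using arr unfolding two_row_array_def by auto
    have p: "pairing \<alpha> = {}"
      using arr c unfolding two_row_array_def row_vertices_def by auto
    have m: "marked \<alpha> = case_row \<R>\<^sub>1 (marked \<alpha> Row2)"
      by (rule ext) (auto simp: m1 split: row.split)
    have "x = f (marked \<alpha> Row2)"
      unfolding x_def f_def \<phi> by (subst m[symmetric]) (use c p in \<open>cases \<alpha>; simp\<close>)
    with m2 show "x \<in> f ` ?S" by blast
  next
    fix x assume "x \<in> f ` ?S"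
    then show "x \<in> ?L"
      using assms
      by (auto simp: f_def \<Delta>_def AR_def two_row_array_def arrow_fun_def forest_condition_def
          psi_def row_vertices_def partition_on_def dom_def subset_iff
          simp del: One_nat_def split: row.splits)
  qed
  then have "T K R1 R2 0 (\<lambda>_. 0) \<R>\<^sub>1 Map.empty = card ?S"
    unfolding T_def using card_image[OF inj_on_subset[OF \<open>inj f\<close>]] by simp
  then show ?thesis
    using n_subsets[of "{1..K}" R2] by simp
qed

end

theory Submission
  imports Defs "HOL-Combinatorics.Permutations"
begin

text \<open>
  Since the two cells of a column have equal size, both rows have the same set \<open>V\<close> of vertices, and a
  pairing is a permutation \<open>\<sigma>\<close> of \<open>V\<close>. Each row imposes that a functional graph determined by the
  values of \<open>\<sigma>\<close> (or of its inverse) at the critical vertices is a forest.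
  If some of the values are prescribed without creating a cycle, leaving \<open>m\<close> vertices free, and if
  \<open>q\<close> of the free targets already lead to a root, then exactly \<open>q \<cdot> (m - 1)!\<close> of the completions
  give a forest.

  Fix the values \<open>\<tau>\<close> on the set \<open>X\<close> of critical vertices of row 1. They force some edges of row 2,
  which form chains of columns \<open>c, b\<^sub>1, b\<^sub>2, \<dots>\<close>, and a free vertex in column \<open>c\<close> leads to a marked
  column of row 2 iff its chain meets the set \<open>S\<close> of marked columns. If \<open>b\<^sub>A\<close> is the first element
  of the chain in \<open>S\<close>, there are \<open>(K - A - 1) choose (R\<^sub>2 - 1)\<close> possibilities for \<open>S\<close>. The number of
  forests of row 1 with a given chain follows from the same count of completions, and summed over
  the free vertices it is \<open>r \<cdot> (s - |X|) \<cdot> (s - A - 1)!\<close>, the same for each of the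
  \<open>M! / (M - A)!\<close> sequences \<open>b\<^sub>1, \<dots>, b\<^sub>A\<close> of critical columns.
\<close>

section \<open>Functional graphs\<close>

text \<open>A map \<open>f\<close> into an option type is a functional graph with the additional sink \<open>None\<close>, the root.\<close>

inductive hits :: "('b \<Rightarrow> 'b option) \<Rightarrow> 'b option set \<Rightarrow> 'b option \<Rightarrow> bool"
  for f A where
  hits_base: "z \<in> A \<Longrightarrow> hits f A z"
| hits_step: "hits f A (f b) \<Longrightarrow> hits f A (Some b)"

lemma hits_None_iff: "hits f A None \<longleftrightarrow> None \<in> A"
  by (subst hits.simps) auto

lemma hits_Some_iff: "hits f A (Some b) \<longleftrightarrow> Some b \<in> A \<or> hits f A (f b)"
  by (subst hits.simps) auto

lemma hits_trans: "hits f A z \<Longrightarrow> (\<And>y. y \<in> A \<Longrightarrow> hits f A' y) \<Longrightarrow> hits f A' z"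
  by (induction rule: hits.induct) (auto intro: hits_step)

lemma hits_mono: "hits f A z \<Longrightarrow> A \<subseteq> A' \<Longrightarrow> hits f A' z"
  by (erule hits_trans) (auto intro: hits_base)

lemma hits_loop:
  assumes "hits f A (Some b)" "f b = Some b"
  shows "Some b \<in> A"
  using assms by (induction "Some b" rule: hits.induct) auto

text \<open>The loop makes \<open>a\<close> a sink, so a walk that arrives at \<open>a\<close> never
  leaves it.\<close>

lemma hits_loop_exclusive:
  assumes "hits f {Some a} z" "f a = Some a"
  shows "\<not> hits f {None} z"
  using assms
proof (induction rule: hits.induct)
  case (hits_base z)
  then show ?case using hits_loop[of f "{None}" a] by auto
next
  case (hits_step b)
  then show ?case using hits_Some_iff[of f "{None}" b] by simp
qed

lemma hits_Un: "hits f (A \<union> A') z \<longleftrightarrow> hits f A z \<or> hits f A' z"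
proof
  show "hits f (A \<union> A') z \<Longrightarrow> hits f A z \<or> hits f A' z"
    by (induction rule: hits.induct) (auto intro: hits.intros)
qed (auto intro: hits_mono)

text \<open>A walk that starts in \<open>B\<close> or at the root stays there, so only the values on
  \<open>B\<close> matter.\<close>

lemma hits_cong:
  assumes "hits f A z" "z \<in> insert None (Some ` B)"
    and "\<And>b. b \<in> B \<Longrightarrow> g b = f b" "\<And>b. b \<in> B \<Longrightarrow> f b \<in> insert None (Some ` B)"
  shows "hits g A z"
  using assms
proof (induction rule: hits.induct)
  case (hits_step b)
  then show ?case by (auto intro!: hits.hits_step)
qed (rule hits.hits_base)

lemma hits_updI:
  assumes "hits f A z" "f a = Some a"
  shows "hits (f(a := t)) A z"
  using assms
proof (induction rule: hits.induct)
  case (hits_step b)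
  then show ?case by (cases "b = a") (auto intro: hits.hits_step)
qed (rule hits.hits_base)

text \<open>Replacing the loop at \<open>a\<close> by an edge to \<open>t\<close> keeps the walks
  that avoid \<open>a\<close> and lets those stuck at \<open>a\<close> continue from
  \<open>t\<close>. They reach the root only if \<open>t\<close> did so before, since a walk from
  \<open>t\<close> back to \<open>a\<close> would close a cycle.\<close>

lemma hits_upd_None_iff:
  assumes "f a = Some a"
  shows "hits (f(a := t)) {None} z \<longleftrightarrow> hits f {None} z \<or> hits f {Some a} z \<and> hits f {None} t"
proof
  show "hits (f(a := t)) {None} z \<Longrightarrow> hits f {None} z \<or> hits f {Some a} z \<and> hits f {None} t"
  proof (induction rule: hits.induct)
    case (hits_step b)
    then show ?case by (cases "b = a") (auto intro: hits.intros)
  qed (auto intro: hits.hits_base)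
next
  assume "hits f {None} z \<or> hits f {Some a} z \<and> hits f {None} t"
  then show "hits (f(a := t)) {None} z"
  proof
    assume *: "hits f {Some a} z \<and> hits f {None} t"
    have "hits (f(a := t)) {None} (Some a)"
      using hits_updI[of f "{None}" t a t] * assms by (simp add: hits_Some_iff)
    with * assms show ?thesis
      by (auto intro: hits_trans dest: hits_updI)
  qed (rule hits_updI[of f, OF _ assms])
qed

section \<open>Permutations inducing a forest\<close>

text \<open>The edges known once the values of the permutation on \<open>D\<close> are fixed; an element whose
  image is not yet known gets a loop, so that it never leads to \<open>None\<close>.\<close>

definition known :: "('b \<Rightarrow> 'a) \<Rightarrow> ('a \<Rightarrow> 'b option) \<Rightarrow> 'a set \<Rightarrow> ('a \<Rightarrow> 'a) \<Rightarrow> 'b \<Rightarrow> 'b option" where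
  "known crit blk D \<tau> b = (if crit b \<in> D then blk (\<tau> (crit b)) else Some b)"

lemma card_Diff_permutes_image:
  assumes "\<tau> permutes V"
  shows "card (V - \<tau> ` D) = card (V - D)"
proof -
  have "V - \<tau> ` D = \<tau> ` (V - D)"
    using permutes_image[OF assms] image_set_diff[OF permutes_inj[OF assms], of V D] by simp
  then show ?thesis
    by (simp add: card_image inj_on_subset[OF permutes_inj[OF assms]])
qed

text \<open>A permutation with the values of \<open>\<tau>\<close> on \<open>D\<close> is
  \<open>\<tau> \<circ> \<rho>\<close> for a unique permutation \<open>\<rho>\<close> of
  \<open>V\<close> that fixes \<open>D\<close>.\<close>

lemma card_permutes_fixed_on:
  assumes "finite V" "\<tau> permutes V" "D \<subseteq> V"
  shows "card {\<sigma>. \<sigma> permutes V \<and> (\<forall>x\<in>D. \<sigma> x = \<tau> x)} = fact (card (V - D))"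
proof -
  have "bij_betw (\<lambda>\<rho>. \<tau> \<circ> \<rho>) {\<rho>. \<rho> permutes (V - D)} {\<sigma>. \<sigma> permutes V \<and> (\<forall>x\<in>D. \<sigma> x = \<tau> x)}"
  proof (rule bij_betw_byWitness[where f' = "\<lambda>\<sigma>. inv \<tau> \<circ> \<sigma>"])
    show "(\<lambda>\<rho>. \<tau> \<circ> \<rho>) ` {\<rho>. \<rho> permutes (V - D)} \<subseteq> {\<sigma>. \<sigma> permutes V \<and> (\<forall>x\<in>D. \<sigma> x = \<tau> x)}"
    proof safe
      fix \<rho> assume \<rho>: "\<rho> permutes (V - D)"
      have "\<rho> permutes V" by (rule permutes_subset[OF \<rho>]) auto
      then show "(\<tau> \<circ> \<rho>) permutes V" using assms(2) by (rule permutes_compose)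
      show "(\<tau> \<circ> \<rho>) x = \<tau> x" if "x \<in> D" for x
        using permutes_not_in[OF \<rho>, of x] that by simp
    qed
    show "(\<lambda>\<sigma>. inv \<tau> \<circ> \<sigma>) ` {\<sigma>. \<sigma> permutes V \<and> (\<forall>x\<in>D. \<sigma> x = \<tau> x)} \<subseteq> {\<rho>. \<rho> permutes (V - D)}"
    proof safe
      fix \<sigma> assume \<sigma>: "\<sigma> permutes V" "\<forall>x\<in>D. \<sigma> x = \<tau> x"
      show "(inv \<tau> \<circ> \<sigma>) permutes (V - D)"
      proof (rule permutes_superset[where S = V])
        show "(inv \<tau> \<circ> \<sigma>) permutes V"
          by (rule permutes_compose[OF \<sigma>(1) permutes_inv[OF assms(2)]])
        show "(inv \<tau> \<circ> \<sigma>) x = x" if "x \<in> V - (V - D)" for x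
          using that \<sigma>(2) permutes_inverses(2)[OF assms(2)] by simp
      qed
    qed
  qed (simp_all add: fun_eq_iff permutes_inverses[OF assms(2)])
  then show ?thesis
    using assms by (simp add: bij_betw_same_card[symmetric] card_permutations)
qed

text \<open>The nodes of the graph are \<open>B\<close> and a root. For a permutation
  \<open>\<sigma>\<close> the edge out of \<open>b\<close> leads to
  \<open>blk (\<sigma> (crit b))\<close>, where \<open>None\<close> is the root. Injectivity of
  \<open>crit\<close> is global so that fixing one further value of the permutation changes
  \<open>known\<close> at one node only.\<close>

locale forest_data =
  fixes V :: "'a set" and B :: "'b set" and crit :: "'b \<Rightarrow> 'a" and blk :: "'a \<Rightarrow> 'b option"
  assumes fin_V: "finite V" and inj_crit: "inj crit" and crit_in: "crit ` B \<subseteq> V"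
    and blk_in: "\<And>x. x \<in> V \<Longrightarrow> blk x \<in> insert None (Some ` B)"
begin

definition is_forest :: "('a \<Rightarrow> 'a) \<Rightarrow> bool" where
  "is_forest \<sigma> \<longleftrightarrow> (\<forall>b\<in>B. hits (\<lambda>b. blk (\<sigma> (crit b))) {None} (Some b))"

text \<open>Undecided nodes carry loops, so a node fails to reach the root or an undecided node
  exactly when the known edges lead it into a cycle.\<close>

definition known_acyclic :: "'a set \<Rightarrow> ('a \<Rightarrow> 'a) \<Rightarrow> bool" where
  "known_acyclic D \<tau> \<longleftrightarrow>
     (\<forall>b\<in>B. hits (known crit blk D \<tau>) ({None} \<union> Some ` {b\<in>B. crit b \<notin> D}) (Some b))"

definition forests :: "'a set \<Rightarrow> ('a \<Rightarrow> 'a) \<Rightarrow> ('a \<Rightarrow> 'a) set" where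
  "forests D \<tau> = {\<sigma>. \<sigma> permutes V \<and> (\<forall>x\<in>D. \<sigma> x = \<tau> x) \<and> is_forest \<sigma>}"

definition rooted :: "'a set \<Rightarrow> ('a \<Rightarrow> 'a) \<Rightarrow> 'a set" where
  "rooted D \<tau> = {y \<in> V - \<tau> ` D. hits (known crit blk D \<tau>) {None} (blk y)}"

lemma fin_B: "finite B"
  using finite_imageD[OF finite_subset[OF crit_in fin_V]] inj_on_subset[OF inj_crit] by blast

lemma known_in:
  assumes "b \<in> B" "\<tau> permutes V"
  shows "known crit blk D \<tau> b \<in> insert None (Some ` B)"
  using assms crit_in blk_in permutes_in_image[of \<tau> V] by (auto simp: known_def)

text \<open>Without undecided nodes \<open>known\<close> is the full graph on \<open>B\<close>, and
  acyclicity sends every node to the root.\<close>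

lemma is_forest_known_all:
  assumes "\<tau> permutes V" "crit ` B \<subseteq> D" "known_acyclic D \<tau>" "\<forall>x\<in>D. \<sigma> x = \<tau> x"
  shows "is_forest \<sigma>"
  unfolding is_forest_def
proof
  fix b assume b: "b \<in> B"
  have U: "{b \<in> B. crit b \<notin> D} = {}" using assms by auto
  have "hits (known crit blk D \<tau>) {None} (Some b)"
    using assms(3) b unfolding known_acyclic_def U by auto
  then show "hits (\<lambda>b. blk (\<sigma> (crit b))) {None} (Some b)"
    by (rule hits_cong[where B = B]) (use b assms known_in in \<open>auto simp: known_def\<close>)
qed

lemma card_forests_known_all:
  assumes "\<tau> permutes V" "D \<subseteq> V" "crit ` B \<subseteq> D" "known_acyclic D \<tau>"
  shows "card (forests D \<tau>) = fact (card (V - D))"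
proof -
  have "forests D \<tau> = {\<sigma>. \<sigma> permutes V \<and> (\<forall>x\<in>D. \<sigma> x = \<tau> x)}"
    using is_forest_known_all[OF assms(1,3,4)] by (auto simp: forests_def)
  then show ?thesis using card_permutes_fixed_on[OF fin_V assms(1,2)] by simp
qed

lemma blk_hits_of_acyclic:
  assumes "known_acyclic D \<tau>" "y \<in> V"
  shows "hits (known crit blk D \<tau>) ({None} \<union> Some ` {b\<in>B. crit b \<notin> D}) (blk y)"
  using blk_in[OF assms(2)] assms(1) by (auto simp: known_acyclic_def intro: hits_base)

text \<open>
  Induction on the number of elements whose image is unknown. When such an element \<open>a\<close> is given the
  target \<open>q\<close>, then a cycle arises if \<open>q\<close> leads to \<open>a\<close>; if \<open>q\<close> is rooted, then all targets leading to \<open>a\<close>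
  become rooted, while \<open>q\<close> is used up; otherwise the rooted targets are unchanged.
\<close>

theorem card_forests:
  assumes "\<tau> permutes V" "D \<subset> V" "known_acyclic D \<tau>"
  shows "card (forests D \<tau>) = card (rooted D \<tau>) * fact (card (V - D) - 1)"
  using assms
proof (induction "card {b\<in>B. crit b \<notin> D}" arbitrary: D \<tau>)
  case 0
  then have U: "{b\<in>B. crit b \<notin> D} = {}" using fin_B by simp
  \<comment> \<open>When all edges are known, every free target is rooted, and the \<open>m!\<close>
    completions are \<open>m\<close> times \<open>(m - 1)!\<close> with \<open>m\<close> the number
    of free vertices.\<close>
  have "rooted D \<tau> = V - \<tau> ` D"
    using blk_hits_of_acyclic[OF 0(4)] U by (auto simp: rooted_def)
  moreover have "card (V - \<tau> ` D) = card (V - D)"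
    by (rule card_Diff_permutes_image[OF 0(2)])
  moreover have "card (V - D) \<noteq> 0" using 0(3) fin_V by auto
  moreover have "card (forests D \<tau>) = fact (card (V - D))"
    using U 0(3,4) by (intro card_forests_known_all 0(2)) auto
  ultimately show ?case
    using fact_reduce[of "card (V - D)", where ?'a = nat] by simp
next
  case (Suc n)
  define U where "U = {b\<in>B. crit b \<notin> D}"
  have "card U \<noteq> 0" using Suc(2) unfolding U_def by simp
  then obtain a where a: "a \<in> U" by (metis card.empty equals0I)
  define c where "c = crit a"
  define W where "W = V - \<tau> ` D"
  define f where "f = known crit blk D \<tau>"
  define La where "La = {y\<in>W. hits f {Some a} (blk y)}"
  define Rt where "Rt = rooted D \<tau>"
  define m where "m = card (V - D)"
  \<comment> \<open>For a free target \<open>q\<close> this keeps the values of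
    \<open>\<tau>\<close> on \<open>D\<close> and sends \<open>c\<close> to \<open>q\<close>; the
    set of forests extending it on \<open>D'\<close> depends on nothing else.\<close>
  define \<tau>q where "\<tau>q q = Transposition.transpose (\<tau> c) q \<circ> \<tau>" for q
  define D' where "D' = insert c D"
  \<comment> \<open>The number of completions when \<open>c\<close> gets a rooted target. For
    \<open>m = 1\<close> the general expression would be \<open>0\<close>, although the unique
    completion is a forest.\<close>
  define e where "e = (if m = 1 then 1 else (card Rt + card La - 1) * fact (m - 2))"
  have c: "c \<in> V" "c \<notin> D" using a crit_in by (auto simp: U_def c_def)
  have D'_sub: "D' \<subseteq> V" using c Suc(4) by (auto simp: D'_def)
  have inj\<tau>: "inj \<tau>" using Suc(3) by (rule permutes_inj)
  have fa: "f a = Some a" using c by (simp add: f_def known_def c_def)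
  have finW: "finite W" by (simp add: W_def fin_V)
  have Rt: "Rt = {y\<in>W. hits f {None} (blk y)}" by (simp add: Rt_def rooted_def W_def f_def)
  have disj: "Rt \<inter> La = {}" using hits_loop_exclusive[where f = f, OF _ fa] by (auto simp: Rt La_def)
  have sub: "Rt \<subseteq> W" "La \<subseteq> W" by (auto simp: Rt La_def)
  have cardW: "card W = m"
    unfolding W_def m_def by (rule card_Diff_permutes_image[OF Suc(3)])
  have cardD': "card (V - D') = m - 1" unfolding m_def D'_def Diff_insert[of V c D] using c by simp
  have m1: "m \<ge> 1" using c fin_V card_gt_0_iff[of "V - D"] unfolding m_def by auto
  have \<tau>q: "\<tau>q q permutes V" "\<tau>q q c = q" "\<And>x. x \<in> D \<Longrightarrow> \<tau>q q x = \<tau> x" if q: "q \<in> W" for q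
  proof -
    show "\<tau>q q permutes V" unfolding \<tau>q_def
      by (intro permutes_compose permutes_swap_id Suc(3))
        (use q c Suc(3) permutes_in_image[of \<tau> V] in \<open>auto simp: W_def\<close>)
    show "\<tau>q q c = q" by (simp add: \<tau>q_def)
    show "\<tau>q q x = \<tau> x" if "x \<in> D" for x
    proof -
      have "\<tau> x \<noteq> \<tau> c" "\<tau> x \<noteq> q" using that c q inj\<tau> by (auto simp: W_def inj_eq)
      then show ?thesis by (simp add: \<tau>q_def transpose_def)
    qed
  qed
  have fq: "known crit blk D' (\<tau>q q) = f(a := blk q)" if "q \<in> W" for q
    using \<tau>q[OF that] inj_crit c by (auto simp: fun_eq_iff known_def f_def D'_def c_def inj_eq)
  have split: "forests D \<tau> = (\<Union>q\<in>W. forests D' (\<tau>q q))"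
  proof (intro set_eqI iffI)
    fix \<sigma> assume \<sigma>: "\<sigma> \<in> forests D \<tau>"
    have "\<sigma> permutes V" "\<forall>x\<in>D. \<sigma> x = \<tau> x" using \<sigma> by (auto simp: forests_def)
    then have "\<sigma> c \<in> W" using c permutes_in_image[of \<sigma> V c] injD[OF permutes_inj, of \<sigma> V c]
      unfolding W_def by (metis DiffI imageE)
    then have "\<sigma> \<in> forests D' (\<tau>q (\<sigma> c))"
      using \<sigma> \<tau>q(2,3) by (auto simp: forests_def D'_def)
    with \<open>\<sigma> c \<in> W\<close> show "\<sigma> \<in> (\<Union>q\<in>W. forests D' (\<tau>q q))" by blast
  next
    fix \<sigma> assume "\<sigma> \<in> (\<Union>q\<in>W. forests D' (\<tau>q q))"
    then show "\<sigma> \<in> forests D \<tau>" using \<tau>q(3) by (auto simp: forests_def D'_def)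
  qed
  have "card (forests D \<tau>) = (\<Sum>q\<in>W. card (forests D' (\<tau>q q)))"
    unfolding split
  proof (rule card_UN_disjoint)
    show "\<forall>q\<in>W. finite (forests D' (\<tau>q q))"
      by (auto simp: forests_def intro: finite_subset[OF _ finite_permutations[OF fin_V]])
    show "\<forall>i\<in>W. \<forall>j\<in>W. i \<noteq> j \<longrightarrow> forests D' (\<tau>q i) \<inter> forests D' (\<tau>q j) = {}"
    proof (intro ballI impI equals0I)
      fix i j \<sigma> assume ij: "i \<in> W" "j \<in> W" "i \<noteq> j"
        and \<sigma>: "\<sigma> \<in> forests D' (\<tau>q i) \<inter> forests D' (\<tau>q j)"
      have "\<sigma> c = \<tau>q i c" "\<sigma> c = \<tau>q j c" using \<sigma> by (auto simp: forests_def D'_def)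
      with \<tau>q(2) ij show False by simp
    qed
  qed (rule finW)
  also have "\<dots> = (\<Sum>q\<in>W. if q \<in> Rt then e
      else if q \<in> La then 0 else card Rt * fact (m - 2))"
  proof (rule sum.cong[OF refl])
    fix q assume q: "q \<in> W"
    have U': "{b\<in>B. crit b \<notin> D'} = U - {a}"
      using inj_crit by (auto simp: U_def D'_def c_def inj_eq)
    show "card (forests D' (\<tau>q q)) = (if q \<in> Rt then e
      else if q \<in> La then 0 else card Rt * fact (m - 2))"
    proof (cases "q \<in> La")
      case True
      have "forests D' (\<tau>q q) = {}"
      proof safe
        fix \<sigma> assume \<sigma>: "\<sigma> \<in> forests D' (\<tau>q q)"
        define g where "g b = blk (\<sigma> (crit b))" for b
        have ga: "g a = blk q" using \<sigma> \<tau>q(2)[OF q] by (auto simp: g_def forests_def D'_def c_def)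
        have gf: "g b = f b" if "crit b \<in> D" for b
          using that \<sigma> \<tau>q(3)[OF q] by (auto simp: g_def f_def known_def forests_def D'_def)
        \<comment> \<open>Before reaching \<open>a\<close> the graph \<open>g\<close> follows the
          known edges, and from \<open>a\<close> it goes to the block of \<open>q\<close>, which
          leads back to \<open>a\<close>; so nothing that leads to \<open>a\<close> reaches the
          root.\<close>
        have "\<not> hits f {Some a} z" if "hits g {None} z" for z
          using that
        proof (induction rule: hits.induct)
          case (hits_step b)
          show ?case
          proof
            assume h: "hits f {Some a} (Some b)"
            show False
            proof (cases "b = a")
              case True
              with hits_step ga \<open>q \<in> La\<close> show False by (simp add: La_def)
            next
              case ne: False
              show False
              proof (cases "crit b \<in> D")
                case True
                with gf hits_step h ne show False by (simp add: hits_Some_iff)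
              next
                case False
                then have "f b = Some b" by (simp add: f_def known_def)
                from hits_loop[OF h this] ne show False by simp
              qed
            qed
          qed
        qed (auto simp: hits_None_iff)
        moreover have "hits g {None} (Some a)"
          using \<sigma> a by (auto simp: forests_def is_forest_def g_def[abs_def] U_def)
        ultimately show "\<sigma> \<in> {}" by (auto intro: hits_base)
      qed
      with True disj show ?thesis by auto
    next
      case nLa: False
      define A' where "A' = {None} \<union> Some ` (U - {a})"
      have A: "{None} \<union> Some ` U = A' \<union> {Some a}" using a by (auto simp: A'_def)
      have split_hits: "hits f A' z \<or> hits f {Some a} z" if "hits f ({None} \<union> Some ` U) z" for z
        using that unfolding A hits_Un .
      have t: "hits f A' (blk q)"
        using split_hits blk_hits_of_acyclic[OF Suc(5), of q] q nLa by (auto simp: La_def W_def f_def U_def)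
      have ha: "hits (f(a := blk q)) A' (Some a)"
        using hits_updI[OF t fa, of "blk q"] by (simp add: hits_Some_iff)
      have acyc: "known_acyclic D' (\<tau>q q)"
        unfolding known_acyclic_def U' fq[OF q] A'_def[symmetric]
      proof
        fix b assume "b \<in> B"
        then have "hits f A' (Some b) \<or> hits f {Some a} (Some b)"
          using Suc(5) split_hits by (auto simp: known_acyclic_def f_def U_def)
        then show "hits (f(a := blk q)) A' (Some b)"
          using hits_updI[where f = f, OF _ fa] ha hits_trans[of _ "{Some a}"] by (metis singletonD)
      qed
      show ?thesis
      proof (cases "m = 1")
        \<comment> \<open>No vertex is free any more, so \<open>D'\<close> is not a proper subset of
          \<open>V\<close> and the induction hypothesis does not apply; the single completion is
          counted directly.\<close>
        case True
        then have "V - D' = {}" using cardD' fin_V by simp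
        with D'_sub have D'V: "D' = V" by auto
        then have U0: "U - {a} = {}" using U' crit_in by auto
        then have "q \<in> Rt" using t[unfolded A'_def U0] q by (simp add: Rt)
        moreover have "W = {q}" using cardW True q by (metis card_1_singletonE singletonD)
        ultimately have "Rt = {q}" "La = {}" using sub disj by auto
        moreover have "card (forests D' (\<tau>q q)) = 1"
          using card_forests_known_all[OF \<tau>q(1)[OF q], of D'] acyc D'V crit_in by simp
        ultimately show ?thesis using True by (simp add: e_def)
      next
        case False
        then have "D' \<noteq> V" using cardD' m1 by auto
        with D'_sub have "D' \<subset> V" by auto
        moreover have "n = card {b\<in>B. crit b \<notin> D'}"
          using Suc(2) a fin_B unfolding U' by (simp add: U_def)
        ultimately have IH: "card (forests D' (\<tau>q q)) = card (rooted D' (\<tau>q q)) * fact (m - 2)"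
          using Suc(1)[OF _ \<tau>q(1)[OF q] _ acyc] cardD' by (simp add: numeral_2_eq_2)
        have img: "\<tau>q q ` D' = insert q (\<tau> ` D)" using \<tau>q(2,3)[OF q] by (auto simp: D'_def image_iff)
        have rt: "rooted D' (\<tau>q q) = {y \<in> W - {q}. hits f {None} (blk y) \<or>
            hits f {Some a} (blk y) \<and> hits f {None} (blk q)}"
          unfolding rooted_def img fq[OF q] hits_upd_None_iff[of f, OF fa] by (auto simp: W_def)
        show ?thesis
        proof (cases "q \<in> Rt")
          case True
          \<comment> \<open>The used target \<open>q\<close> drops out, and every target in
            \<open>La\<close> now continues through the block of \<open>q\<close> to the
            root.\<close>
          then have "rooted D' (\<tau>q q) = (Rt \<union> La) - {q}" unfolding rt by (auto simp: Rt La_def)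
          then have "card (rooted D' (\<tau>q q)) = card Rt + card La - 1"
            using True disj finW sub by (simp add: card_Un_disjoint finite_subset)
          with True IH \<open>m \<noteq> 1\<close> show ?thesis by (simp add: e_def)
        next
          case False
          then have "rooted D' (\<tau>q q) = Rt" unfolding rt using q by (auto simp: Rt)
          with False nLa IH show ?thesis by simp
        qed
      qed
    qed
  qed
  also have "\<dots> = card Rt * e
      + (m - card Rt - card La) * (card Rt * fact (m - 2))"
  proof -
    have "W \<inter> Rt = Rt" "W \<inter> - Rt \<inter> - La = W - Rt - La" using sub by auto
    then have "(\<Sum>q\<in>W. if q \<in> Rt then e else if q \<in> La then 0 else card Rt * fact (m - 2))
        = card Rt * e + card (W - Rt - La) * (card Rt * fact (m - 2))"
      using finW by (simp add: sum.If_cases)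
    also have "card (W - Rt - La) = m - card Rt - card La"
    proof -
      have "finite Rt" "finite La" using sub finW by (auto intro: finite_subset)
      moreover have "W - Rt - La = W - (Rt \<union> La)" by auto
      ultimately show ?thesis
        using disj sub cardW by (simp add: card_Diff_subset card_Un_disjoint)
    qed
    finally show ?thesis .
  qed
  \<comment> \<open>With \<open>t = |Rt|\<close> and \<open>l = |La|\<close> this is
    \<open>t (t + l - 1) + (m - t - l) t = t (m - 1)\<close>, times \<open>(m - 2)!\<close>.
    Truncated subtraction makes \<open>1 \<le> t\<close> and \<open>t + l \<le> m\<close>
    necessary.\<close>
  also have "\<dots> = card Rt * fact (m - 1)"
  proof (cases "card Rt = 0")
    case False
    have le: "card Rt + card La \<le> m"
      using disj finW sub cardW by (metis Un_least card_Un_disjoint card_mono finite_subset)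
    show ?thesis
    proof (cases "m = 1")
      case True
      with le False have "card Rt = 1" "card La = 0" by auto
      with True show ?thesis by (simp add: e_def)
    next
      case m: False
      have "card Rt * e + (m - card Rt - card La) * (card Rt * fact (m - 2))
          = card Rt * ((card Rt + card La - 1 + (m - card Rt - card La)) * fact (m - 2))"
        using m by (simp add: e_def add_mult_distrib add_mult_distrib2)
      also have "card Rt + card La - 1 + (m - card Rt - card La) = m - 1"
        using le False by simp
      also have "(m - 1) * fact (m - 2) = fact (m - 1)"
        using m m1 fact_reduce[of "m - 1", where ?'a = nat] by (simp add: numeral_2_eq_2)
      finally show ?thesis .
    qed
  qed simp
  finally show ?case by (simp add: Rt_def m_def)
qed

end

section \<open>Heights in a forest, and subsets with a prescribed first hit\<close>

text \<open>The rank is the number of steps to the root. \<open>Option.bind\<close> makes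
  \<open>None\<close> absorbing, so it is the first time at which an iterate equals
  \<open>None\<close>.\<close>

lemma hits_rank:
  obtains d :: "'b option \<Rightarrow> nat"
  where "\<And>b. hits g {None} (Some b) \<Longrightarrow> d (Some b) = Suc (d (g b))"
proof -
  define F where "F z = Option.bind z g" for z
  define d where "d z = (LEAST n. (F ^^ n) z = None)" for z
  have ex: "\<exists>n. (F ^^ n) z = None" if "hits g {None} z" for z
    using that
  proof (induction rule: hits.induct)
    case (hits_base z)
    then show ?case by (intro exI[of _ 0]) simp
  next
    case (hits_step b)
    then obtain n where "(F ^^ n) (g b) = None" by blast
    then have "(F ^^ Suc n) (Some b) = None" by (simp add: funpow_swap1 F_def)
    then show ?case by blast
  qed
  show ?thesis
  proof (rule that[of d])
    fix b assume "hits g {None} (Some b)"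
    with ex obtain n where n: "(F ^^ n) (Some b) = None" by blast
    have "d (Some b) = Suc (LEAST m. (F ^^ Suc m) (Some b) = None)"
      unfolding d_def by (rule Least_Suc[where P = "\<lambda>n. (F ^^ n) (Some b) = None", OF n]) simp
    also have "(\<lambda>m. (F ^^ Suc m) (Some b) = None) = (\<lambda>m. (F ^^ m) (g b) = None)"
      by (simp add: funpow_swap1 F_def fun_eq_iff)
    finally show "d (Some b) = Suc (d (g b))" by (simp add: d_def)
  qed
qed

text \<open>Removing \<open>l\<close> leaves an arbitrary set of \<open>r - 1\<close> elements of
  \<open>I\<close> that avoids \<open>Y\<close> and \<open>l\<close>.\<close>

lemma card_subsets_first_hit:
  assumes "finite I" "l \<in> I" "Y \<subseteq> I" "l \<notin> Y" "1 \<le> r"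
  shows "card {S. S \<subseteq> I \<and> card S = r \<and> l \<in> S \<and> Y \<inter> S = {}} = (card I - card Y - 1) choose (r - 1)"
proof -
  have "bij_betw (insert l) {S. S \<subseteq> I - Y - {l} \<and> card S = r - 1}
      {S. S \<subseteq> I \<and> card S = r \<and> l \<in> S \<and> Y \<inter> S = {}}"
  proof (rule bij_betw_byWitness[where f' = "\<lambda>S. S - {l}"])
    show "insert l ` {S. S \<subseteq> I - Y - {l} \<and> card S = r - 1}
        \<subseteq> {S. S \<subseteq> I \<and> card S = r \<and> l \<in> S \<and> Y \<inter> S = {}}"
    proof safe
      fix S assume S: "S \<subseteq> I - Y - {l}" "card S = r - 1"
      have "finite S" using S(1) assms(1) by (auto intro: finite_subset)
      moreover have "l \<notin> S" using S(1) by auto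
      ultimately show "card (insert l S) = r" using S(2) assms(5) by simp
    qed (use assms in auto)
    show "(\<lambda>S. S - {l}) ` {S. S \<subseteq> I \<and> card S = r \<and> l \<in> S \<and> Y \<inter> S = {}}
        \<subseteq> {S. S \<subseteq> I - Y - {l} \<and> card S = r - 1}"
      by auto
  qed auto
  then have "card {S. S \<subseteq> I \<and> card S = r \<and> l \<in> S \<and> Y \<inter> S = {}}
      = card {S. S \<subseteq> I - Y - {l} \<and> card S = r - 1}"
    by (simp add: bij_betw_same_card)
  also have "\<dots> = card (I - Y - {l}) choose (r - 1)"
    using assms by (intro n_subsets) auto
  also have "card (I - Y - {l}) = card I - card Y - 1"
    using assms by (simp add: card_Diff_subset finite_subset)
  finally show ?thesis .
qed

section \<open>Columns\<close>

text \<open>An arrow leads to a column without an arrow, so a column with an arrow can be merged with its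
  target; the marked columns are merged into the root.\<close>

definition block :: "nat set \<Rightarrow> (nat \<rightharpoonup> nat) \<Rightarrow> nat \<Rightarrow> nat option" where
  "block R \<phi> j = (if j \<in> R then None else if j \<in> dom \<phi> then \<phi> j else Some j)"

text \<open>The last assumption is what admissibility says about arrows: each ends in a column with
  a critical vertex in row 1.\<close>

locale columns =
  fixes I :: "nat set" and w :: "nat \<Rightarrow> nat" and R :: "nat set" and \<phi> :: "nat \<rightharpoonup> nat"
  assumes fin_I: "finite I" and R_sub: "R \<subseteq> I" and dom_sub: "dom \<phi> \<subseteq> I - R"
    and arrow: "\<And>j k. \<phi> j = Some k \<Longrightarrow> k \<in> I \<and> k \<notin> R \<and> k \<notin> dom \<phi> \<and> 1 \<le> w k"
begin

text \<open>A permutation \<open>\<sigma>\<close> of \<open>V\<close> stands for the pairing of \<open>(Row1, v)\<close> with \<open>(Row2, \<sigma> v)\<close>. For row 2 the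
  arrow function is empty and \<open>\<sigma>\<close> is replaced by its inverse.\<close>

definition V :: "(nat \<times> nat) set" where "V = Sigma I (\<lambda>j. {1..w j})"

definition top_vertex :: "nat \<Rightarrow> nat \<times> nat" where "top_vertex j = (j, w j)"

definition crit_cols :: "nat set \<Rightarrow> (nat \<rightharpoonup> nat) \<Rightarrow> nat set" where
  "crit_cols Q f = {j\<in>I. 1 \<le> w j \<and> j \<notin> Q \<and> j \<notin> dom f}"

abbreviation C where "C \<equiv> crit_cols R \<phi>"
abbreviation X where "X \<equiv> top_vertex ` C"
abbreviation blk where "blk \<equiv> block R \<phi>"
abbreviation blk2 where "blk2 S \<equiv> block S Map.empty"

text \<open>The forest condition of one row after merging: a nonempty column without a critical
  vertex belongs to the root if it is marked and to the target of its arrow otherwise. The link to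
  the original condition is \<open>row_forest_iff_psi\<close>.\<close>

definition row_forest :: "nat set \<Rightarrow> (nat \<rightharpoonup> nat) \<Rightarrow> (nat \<times> nat \<Rightarrow> nat \<times> nat) \<Rightarrow> bool" where
  "row_forest Q f \<sigma> \<longleftrightarrow>
     (\<forall>b\<in>crit_cols Q f. hits (\<lambda>b. block Q f (fst (\<sigma> (top_vertex b)))) {None} (Some b))"

lemma inj_top: "inj top_vertex" by (auto simp: inj_def top_vertex_def)

lemma fst_top [simp]: "fst (top_vertex j) = j" by (simp add: top_vertex_def)

lemma fin_V: "finite V" unfolding V_def using fin_I by auto

lemma top_in_V: "j \<in> I \<Longrightarrow> 1 \<le> w j \<Longrightarrow> top_vertex j \<in> V"
  by (auto simp: top_vertex_def V_def)

lemma fin_C: "finite C" unfolding crit_cols_def using fin_I by auto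

lemma crit_tops_sub: "top_vertex ` crit_cols Q f \<subseteq> V"
  unfolding crit_cols_def using top_in_V by blast

lemma X_sub: "X \<subseteq> V" by (rule crit_tops_sub)

lemma card_X: "card X = card C" by (intro card_image inj_on_subset[OF inj_top]) auto

lemma blk_C: "b \<in> C \<Longrightarrow> blk b = Some b" by (auto simp: block_def crit_cols_def)

sublocale row1: forest_data V C top_vertex "\<lambda>x. blk (fst x)"
proof
  fix x assume "x \<in> V"
  then have x: "fst x \<in> I" "1 \<le> w (fst x)" by (auto simp: V_def)
  show "blk (fst x) \<in> insert None (Some ` C)"
    using x arrow[of "fst x"] by (auto simp: block_def crit_cols_def)
qed (use fin_V inj_top X_sub in auto)

sublocale row2: forest_data V "crit_cols S Map.empty" top_vertex "\<lambda>x. blk2 S (fst x)" for S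
proof
  fix x assume "x \<in> V"
  then have x: "fst x \<in> I" "1 \<le> w (fst x)" by (auto simp: V_def)
  show "blk2 S (fst x) \<in> insert None (Some ` crit_cols S Map.empty)"
    using x by (auto simp: block_def crit_cols_def)
qed (use fin_V inj_top crit_tops_sub in auto)

lemma row_forest_row1: "row_forest R \<phi> \<sigma> \<longleftrightarrow> row1.is_forest \<sigma>"
  by (simp add: row_forest_def row1.is_forest_def)

lemma row_forest_row2: "row_forest S Map.empty \<sigma> \<longleftrightarrow> row2.is_forest S \<sigma>"
  by (simp add: row_forest_def row2.is_forest_def)

text \<open>The edges of row 2 forced by the partners of the critical vertices of row 1.\<close>

definition chain_step :: "nat set \<Rightarrow> (nat \<times> nat \<Rightarrow> nat \<times> nat) \<Rightarrow> nat \<Rightarrow> nat option" where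
  "chain_step S \<tau> = known top_vertex (\<lambda>x. blk2 S (fst x)) (\<tau> ` X) (inv \<tau>)"

definition row1_perms :: "(nat \<times> nat \<Rightarrow> nat \<times> nat) set" where
  "row1_perms = {\<tau>. \<tau> permutes V \<and> row_forest R \<phi> \<tau>}"

lemma fin_row1_perms: "finite row1_perms"
  unfolding row1_perms_def by (rule finite_subset[OF _ finite_permutations[OF fin_V]]) auto

text \<open>The graph of row 1 reads the permutation at the critical vertices \<open>X\<close>
  only.\<close>

lemma row_forest_cong:
  assumes "\<And>x. x \<in> X \<Longrightarrow> \<sigma> x = \<tau> x" "\<tau> permutes V" "row_forest R \<phi> \<tau>"
  shows "row_forest R \<phi> \<sigma>"
  unfolding row_forest_def
proof
  fix b assume b: "b \<in> C"
  then have "hits (\<lambda>b. blk (fst (\<tau> (top_vertex b)))) {None} (Some b)"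
    using assms(3) by (simp add: row_forest_def)
  then show "hits (\<lambda>b. blk (fst (\<sigma> (top_vertex b)))) {None} (Some b)"
  proof (rule hits_cong[where B = C])
    fix b assume b: "b \<in> C"
    have "\<tau> (top_vertex b) \<in> V"
      using assms(2) X_sub b by (auto simp: permutes_in_image)
    then show "blk (fst (\<tau> (top_vertex b))) \<in> insert None (Some ` C)" by (rule row1.blk_in)
  qed (use b assms(1) in auto)
qed

lemma row1_perms_agree:
  assumes "\<tau> \<in> row1_perms" "\<forall>x\<in>X. \<sigma> x = \<tau> x"
  shows "\<sigma> \<in> row1_perms \<longleftrightarrow> \<sigma> permutes V"
proof -
  have "row_forest R \<phi> \<sigma>"
    by (rule row_forest_cong[of \<sigma> \<tau>]) (use assms in \<open>auto simp: row1_perms_def\<close>)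
  then show ?thesis by (simp add: row1_perms_def)
qed

lemma row1_rank:
  assumes "row_forest R \<phi> \<tau>"
  obtains d :: "nat option \<Rightarrow> nat"
  where "\<And>b. b \<in> C \<Longrightarrow> d (Some b) = Suc (d (blk (fst (\<tau> (top_vertex b)))))"
proof -
  obtain d :: "nat option \<Rightarrow> nat"
    where "\<And>b. hits (\<lambda>b. blk (fst (\<tau> (top_vertex b)))) {None} (Some b) \<Longrightarrow>
      d (Some b) = Suc (d (blk (fst (\<tau> (top_vertex b)))))"
    using hits_rank by blast
  with that assms show ?thesis unfolding row_forest_def by blast
qed

text \<open>The top vertex of \<open>k\<close> in row 2 is paired with the critical vertex of
  \<open>b\<close> in row 1, so the edge out of \<open>k\<close> in row 2 leads to
  \<open>b\<close>.\<close>

lemma chain_step_X: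
  assumes "\<tau> permutes V" "b \<in> C" "\<tau> (top_vertex b) = top_vertex k"
  shows "chain_step S \<tau> k = blk2 S b"
proof -
  have "top_vertex k \<in> \<tau> ` X" using assms(2) assms(3)[symmetric] by blast
  moreover have "inv \<tau> (top_vertex k) = top_vertex b"
    using permutes_inverses(2)[OF assms(1), of "top_vertex b"] assms(3) by simp
  ultimately show ?thesis by (simp add: chain_step_def known_def)
qed

lemma chain_step_not_X: "top_vertex k \<notin> \<tau> ` X \<Longrightarrow> chain_step S \<tau> k = Some k"
  by (simp add: chain_step_def known_def)

text \<open>A forced edge of row 2 reverses an edge of row 1, so it increases the height in the row 1 forest.\<close>

lemma row2_known_acyclic:
  assumes "\<tau> \<in> row1_perms"
  shows "row2.known_acyclic S (\<tau> ` X) (inv \<tau>)"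
  unfolding row2.known_acyclic_def chain_step_def[symmetric]
proof
  have \<tau>: "\<tau> permutes V" "row_forest R \<phi> \<tau>" using assms by (auto simp: row1_perms_def)
  obtain d :: "nat option \<Rightarrow> nat"
    where d: "\<And>b. b \<in> C \<Longrightarrow> d (Some b) = Suc (d (blk (fst (\<tau> (top_vertex b)))))"
    using row1_rank[OF \<tau>(2)] by blast
  \<comment> \<open>A bound on the heights; since forced edges climb, \<open>N - d (blk k)\<close>
    decreases along the walk.\<close>
  define N where "N = Max ((\<lambda>k. d (blk k)) ` I)"
  have N: "d (blk k) \<le> N" if "k \<in> I" for k unfolding N_def using fin_I that by auto
  let ?A = "{None} \<union> Some ` {b \<in> crit_cols S Map.empty. top_vertex b \<notin> \<tau> ` X}"
  fix k assume "k \<in> crit_cols S Map.empty"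
  then show "hits (chain_step S \<tau>) ?A (Some k)"
  proof (induction "N - d (blk k)" arbitrary: k rule: less_induct)
    case less
    show ?case
    proof (cases "top_vertex k \<in> \<tau> ` X")
      case False
      with less.prems show ?thesis by (intro hits_base) auto
    next
      case True
      then obtain b where b: "b \<in> C" "\<tau> (top_vertex b) = top_vertex k" by (metis imageE)
      have db: "d (blk b) = Suc (d (blk k))" using d[OF b(1)] b blk_C by simp
      have bI: "b \<in> I" "1 \<le> w b" using b by (auto simp: crit_cols_def)
      show ?thesis
      proof (rule hits_step, unfold chain_step_X[OF \<tau>(1) b], cases "b \<in> S")
        case True
        then show "hits (chain_step S \<tau>) ?A (blk2 S b)" by (auto simp: block_def intro: hits_base)
      next
        case False
        with bI have "b \<in> crit_cols S Map.empty" by (simp add: crit_cols_def)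
        moreover have "N - d (blk b) < N - d (blk k)" using N[OF bI(1)] db by simp
        ultimately have "hits (chain_step S \<tau>) ?A (Some b)" using less.hyps by blast
        with False show "hits (chain_step S \<tau>) ?A (blk2 S b)" by (simp add: block_def)
      qed
    qed
  qed
qed

text \<open>Inversion turns the permutations that agree with \<open>\<tau>\<close> on
  \<open>X\<close> into those prescribed on the image of \<open>X\<close>, with \<open>V - X\<close>
  as free targets, so \<open>card_forests\<close> applies to row 2.\<close>

lemma card_agree_row2:
  assumes \<tau>: "\<tau> \<in> row1_perms" and less: "card C < card V"
  shows "card {\<sigma>. \<sigma> permutes V \<and> (\<forall>x\<in>X. \<sigma> x = \<tau> x) \<and> row_forest S Map.empty (inv \<sigma>)}
    = card {x \<in> V - X. hits (chain_step S \<tau>) {None} (blk2 S (fst x))} * fact (card V - card C - 1)"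
proof -
  have \<tau>p: "\<tau> permutes V" using \<tau> by (simp add: row1_perms_def)
  have inv\<tau>: "inv \<tau> permutes V" by (rule permutes_inv[OF \<tau>p])
  have inj\<tau>: "inj \<tau>" by (rule permutes_inj[OF \<tau>p])
  have "bij_betw inv {\<sigma>. \<sigma> permutes V \<and> (\<forall>x\<in>X. \<sigma> x = \<tau> x) \<and> row_forest S Map.empty (inv \<sigma>)}
      (row2.forests S (\<tau> ` X) (inv \<tau>))"
  proof (rule bij_betw_byWitness[where f' = inv])
    show "inv ` {\<sigma>. \<sigma> permutes V \<and> (\<forall>x\<in>X. \<sigma> x = \<tau> x) \<and> row_forest S Map.empty (inv \<sigma>)}
        \<subseteq> row2.forests S (\<tau> ` X) (inv \<tau>)"
    proof (rule image_subsetI)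
      fix \<sigma> assume "\<sigma> \<in> {\<sigma>. \<sigma> permutes V \<and> (\<forall>x\<in>X. \<sigma> x = \<tau> x) \<and> row_forest S Map.empty (inv \<sigma>)}"
      then have \<sigma>: "\<sigma> permutes V" "\<forall>x\<in>X. \<sigma> x = \<tau> x" "row_forest S Map.empty (inv \<sigma>)" by blast+
      have "inv \<sigma> (\<tau> x) = inv \<tau> (\<tau> x)" if "x \<in> X" for x
        using permutes_inverses(2)[OF \<sigma>(1), of x] permutes_inverses(2)[OF \<tau>p, of x]
        unfolding bspec[OF \<sigma>(2) that] by simp
      then show "inv \<sigma> \<in> row2.forests S (\<tau> ` X) (inv \<tau>)"
        using \<sigma> permutes_inv[OF \<sigma>(1)] by (auto simp: row2.forests_def row_forest_row2)
    qed
    show "inv ` row2.forests S (\<tau> ` X) (inv \<tau>)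
        \<subseteq> {\<sigma>. \<sigma> permutes V \<and> (\<forall>x\<in>X. \<sigma> x = \<tau> x) \<and> row_forest S Map.empty (inv \<sigma>)}"
    proof (rule image_subsetI)
      fix \<rho> assume "\<rho> \<in> row2.forests S (\<tau> ` X) (inv \<tau>)"
      then have \<rho>: "\<rho> permutes V" "\<forall>x\<in>X. \<rho> (\<tau> x) = inv \<tau> (\<tau> x)" "row_forest S Map.empty \<rho>"
        by (auto simp: row2.forests_def row_forest_row2)
      have "inv \<rho> x = \<tau> x" if "x \<in> X" for x
      proof -
        have "\<rho> (\<tau> x) = x" using bspec[OF \<rho>(2) that] permutes_inverses(2)[OF \<tau>p, of x] by simp
        then show ?thesis using permutes_inverses(2)[OF \<rho>(1), of "\<tau> x"] by simp
      qed
      then show "inv \<rho> \<in> {\<sigma>. \<sigma> permutes V \<and> (\<forall>x\<in>X. \<sigma> x = \<tau> x) \<and> row_forest S Map.empty (inv \<sigma>)}"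
        using \<rho>(3) permutes_inv_inv[OF \<rho>(1)] permutes_inv[OF \<rho>(1)] by simp
    qed
  qed (unfold row2.forests_def, blast intro: permutes_inv_inv, blast intro: permutes_inv_inv)
  then have "card {\<sigma>. \<sigma> permutes V \<and> (\<forall>x\<in>X. \<sigma> x = \<tau> x) \<and> row_forest S Map.empty (inv \<sigma>)}
      = card (row2.forests S (\<tau> ` X) (inv \<tau>))" by (rule bij_betw_same_card)
  also have "\<dots> = card (row2.rooted S (\<tau> ` X) (inv \<tau>)) * fact (card (V - \<tau> ` X) - 1)"
  proof (rule row2.card_forests[OF inv\<tau>])
    have "\<tau> ` X \<subseteq> V" using X_sub permutes_image[OF \<tau>p] by blast
    moreover have "card (\<tau> ` X) = card C"
      using card_X card_image[OF inj_on_subset[OF inj\<tau>], of X] by simp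
    ultimately show "\<tau> ` X \<subset> V" using less by auto
  qed (rule row2_known_acyclic[OF \<tau>])
  also have "card (V - \<tau> ` X) = card V - card C"
    using card_Diff_permutes_image[OF \<tau>p, of X] card_Diff_subset[OF finite_subset[OF X_sub fin_V] X_sub] card_X
    by simp
  also have "inv \<tau> ` \<tau> ` X = X" using inj\<tau> by (simp add: image_inv_f_f)
  then have "row2.rooted S (\<tau> ` X) (inv \<tau>) = {x \<in> V - X. hits (chain_step S \<tau>) {None} (blk2 S (fst x))}"
    by (simp add: row2.rooted_def chain_step_def)
  finally show ?thesis .
qed

text \<open>Double counting of pairs of permutations that agree on \<open>X\<close>: each permutation agrees with
  \<open>(card V - card C)!\<close> others, and a fixed row 1 forest is completed by the preceding lemma.\<close>

lemma double_count_row2: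
  assumes less: "card C < card V"
  shows "(card V - card C) * card {\<sigma> \<in> row1_perms. row_forest S Map.empty (inv \<sigma>)}
    = (\<Sum>\<tau>\<in>row1_perms. card {x \<in> V - X. hits (chain_step S \<tau>) {None} (blk2 S (fst x))})"
proof -
  define Q where "Q = {\<sigma> \<in> row1_perms. row_forest S Map.empty (inv \<sigma>)}"
  define m where "m = card V - card C"
  define agree where "agree f g \<longleftrightarrow> (\<forall>x\<in>X. f x = g x)" for f g :: "nat \<times> nat \<Rightarrow> nat \<times> nat"
  define N where "N \<tau> = card {x \<in> V - X. hits (chain_step S \<tau>) {None} (blk2 S (fst x))}" for \<tau>
  have m: "m \<ge> 1" "card (V - X) = m"
    using less card_Diff_subset[OF finite_subset[OF X_sub fin_V] X_sub] card_X by (auto simp: m_def)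
  have "(\<Sum>\<sigma>\<in>Q. card {\<tau> \<in> row1_perms. agree \<tau> \<sigma>}) = (\<Sum>\<tau>\<in>row1_perms. N \<tau> * fact (m - 1))"
  proof (rule sum_multicount_gen)
    show "\<forall>\<tau>\<in>row1_perms. card {\<sigma> \<in> Q. agree \<tau> \<sigma>} = N \<tau> * fact (m - 1)"
    proof
      fix \<tau> assume \<tau>: "\<tau> \<in> row1_perms"
      have "{\<sigma> \<in> Q. agree \<tau> \<sigma>} =
        {\<sigma>. \<sigma> permutes V \<and> (\<forall>x\<in>X. \<sigma> x = \<tau> x) \<and> row_forest S Map.empty (inv \<sigma>)}"
        unfolding Q_def agree_def ball_cong[OF refl eq_commute, of X \<tau>] using row1_perms_agree[OF \<tau>] by blast
      then show "card {\<sigma> \<in> Q. agree \<tau> \<sigma>} = N \<tau> * fact (m - 1)"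
        using card_agree_row2[OF \<tau> less] by (simp add: N_def m_def)
    qed
  qed (auto simp: Q_def fin_row1_perms)
  moreover have "card {\<tau> \<in> row1_perms. agree \<tau> \<sigma>} = fact m" if "\<sigma> \<in> Q" for \<sigma>
  proof -
    have \<sigma>: "\<sigma> permutes V" "row_forest R \<phi> \<sigma>" using that by (auto simp: Q_def row1_perms_def)
    \<comment> \<open>Agreement with \<open>\<sigma>\<close> on \<open>X\<close> already makes
      \<open>\<tau>\<close> a forest of row 1, so all permutations with these values are
      counted.\<close>
    have "{\<tau> \<in> row1_perms. agree \<tau> \<sigma>} = {\<tau>. \<tau> permutes V \<and> (\<forall>x\<in>X. \<tau> x = \<sigma> x)}"
      using row1_perms_agree[of \<sigma>] that unfolding Q_def agree_def by blast
    then show ?thesis using card_permutes_fixed_on[OF fin_V \<sigma>(1) X_sub] m by simp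
  qed
  ultimately have "card Q * fact m = (\<Sum>\<tau>\<in>row1_perms. N \<tau>) * fact (m - 1)"
    by (simp add: sum_distrib_right)
  moreover have "fact m = m * (fact (m - 1) :: nat)" using m fact_reduce[of m, where ?'a = nat] by simp
  ultimately have "(m * card Q) * fact (m - 1) = (\<Sum>\<tau>\<in>row1_perms. N \<tau>) * (fact (m - 1) :: nat)"
    by (simp add: mult_ac)
  then show ?thesis by (simp add: m_def N_def Q_def)
qed

section \<open>Chains of forced edges\<close>

text \<open>The chain is followed in the direction of row 2; in row 1 each of its columns points
  back to the block of the preceding one. It is described by \<open>\<tau>\<close> alone, so that
  the sets \<open>S\<close> can be counted for a fixed chain.\<close>

fun path :: "(nat \<times> nat \<Rightarrow> nat \<times> nat) \<Rightarrow> nat \<Rightarrow> nat list \<Rightarrow> bool" where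
  "path \<tau> c [] = True"
| "path \<tau> c (b # bs) = (b \<in> C \<and> \<tau> (top_vertex b) = top_vertex c \<and> path \<tau> b bs)"

definition first_hit :: "nat set \<Rightarrow> nat \<Rightarrow> nat list \<Rightarrow> bool" where
  "first_hit S c bs \<longleftrightarrow> last (c # bs) \<in> S \<and> set (butlast (c # bs)) \<inter> S = {}"

lemma first_hit_Nil [simp]: "first_hit S c [] \<longleftrightarrow> c \<in> S"
  by (simp add: first_hit_def)

lemma first_hit_Cons [simp]: "first_hit S c (b # bs) \<longleftrightarrow> c \<notin> S \<and> first_hit S b bs"
  by (auto simp: first_hit_def)

lemma path_hits:
  assumes "\<tau> permutes V" "path \<tau> c bs" "first_hit S c bs"
  shows "hits (chain_step S \<tau>) {None} (blk2 S c)"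
  using assms
proof (induction bs arbitrary: c)
  case Nil
  then show ?case by (auto simp: block_def intro: hits_base)
next
  case (Cons b bs)
  then have "hits (chain_step S \<tau>) {None} (chain_step S \<tau> c)"
    using chain_step_X[of \<tau> b c S] by simp
  moreover have "blk2 S c = Some c" using Cons by (simp add: block_def)
  ultimately show ?case by (simp add: hits_step)
qed

lemma hits_path:
  assumes "hits (chain_step S \<tau>) {None} z" "z = blk2 S c" "\<tau> permutes V"
  shows "\<exists>bs. path \<tau> c bs \<and> first_hit S c bs"
  using assms
proof (induction arbitrary: c rule: hits.induct)
  case (hits_base z)
  then have "c \<in> S" by (auto simp: block_def split: if_splits)
  then show ?case by (intro exI[of _ "[]"]) simp
next
  case (hits_step k)
  then have c: "c = k" "k \<notin> S" by (auto simp: block_def split: if_splits)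
  show ?case
  proof (cases "top_vertex k \<in> \<tau> ` X")
    case False
    \<comment> \<open>An undecided column is its own successor, so the induction hypothesis speaks
      of the same column.\<close>
    from chain_step_not_X[OF this] have "chain_step S \<tau> k = blk2 S k" using c by (simp add: block_def)
    from hits_step.IH[OF this hits_step.prems(2)] c show ?thesis by simp
  next
    case True
    then obtain b where b: "b \<in> C" "\<tau> (top_vertex b) = top_vertex k" by (metis imageE)
    then obtain bs where "path \<tau> b bs" "first_hit S b bs"
      using hits_step.IH[OF chain_step_X[OF hits_step.prems(2) b] hits_step.prems(2)] by blast
    then show ?thesis using b c by (intro exI[of _ "b # bs"]) simp
  qed
qed

text \<open>Injectivity of \<open>\<tau>\<close> determines each next column, and \<open>S\<close>
  determines where to stop.\<close>

lemma first_hit_unique: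
  assumes "\<tau> permutes V" "path \<tau> c bs" "first_hit S c bs" "path \<tau> c bs'" "first_hit S c bs'"
  shows "bs = bs'"
  using assms(2-)
proof (induction bs arbitrary: c bs')
  case Nil
  then show ?case by (cases bs') auto
next
  case (Cons b bs)
  then obtain b' bs'' where bs': "bs' = b' # bs''" by (cases bs') auto
  have "\<tau> (top_vertex b) = \<tau> (top_vertex b')" using Cons bs' by simp
  then have "b = b'" using permutes_inj[OF assms(1)] inj_top by (simp add: inj_eq)
  then show ?case using Cons bs' by auto
qed

lemma path_C: "path \<tau> c bs \<Longrightarrow> set bs \<subseteq> C"
  by (induction bs arbitrary: c) auto

text \<open>Heights in the forest of row 1 increase strictly along a chain, starting above the block
  of \<open>c\<close>.\<close>

lemma path_distinct:
  assumes "\<tau> \<in> row1_perms" "path \<tau> c bs"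
  shows "distinct (c # bs)" "blk c \<notin> Some ` set bs"
proof -
  obtain d :: "nat option \<Rightarrow> nat"
    where d: "\<And>b. b \<in> C \<Longrightarrow> d (Some b) = Suc (d (blk (fst (\<tau> (top_vertex b)))))"
    using row1_rank assms(1) unfolding row1_perms_def by blast
  have *: "distinct bs \<and> (\<forall>b\<in>set bs. d (blk c) < d (Some b))"
    using assms(2)
  proof (induction bs arbitrary: c)
    case (Cons b bs)
    then have IH: "distinct bs" "\<forall>b'\<in>set bs. d (blk b) < d (Some b')" by auto
    have "d (Some b) = Suc (d (blk c))" "blk b = Some b" using Cons d[of b] blk_C by auto
    with IH show ?case by force
  qed simp
  then show avoid: "blk c \<notin> Some ` set bs" by (metis imageE less_irrefl)
  have "c \<notin> set bs" using avoid path_C[OF assms(2)] blk_C by blast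
  with * show "distinct (c # bs)" by simp
qed

lemma path_cong: "path \<tau> c bs \<Longrightarrow> (\<And>b. b \<in> set bs \<Longrightarrow> \<sigma> (top_vertex b) = \<tau> (top_vertex b)) \<Longrightarrow> path \<sigma> c bs"
  by (induction bs arbitrary: c) auto

lemma path_agree: "path \<tau> c bs \<Longrightarrow> path \<sigma> c bs \<Longrightarrow> b \<in> set bs \<Longrightarrow> \<sigma> (top_vertex b) = \<tau> (top_vertex b)"
  by (induction bs arbitrary: c) auto

lemma path_image: "path \<tau> c bs \<Longrightarrow> \<tau> ` top_vertex ` set bs = top_vertex ` set (butlast (c # bs))"
proof (induction bs arbitrary: c)
  case (Cons b bs)
  have IH: "\<tau> ` top_vertex ` set bs = top_vertex ` set (butlast (b # bs))"
    by (rule Cons.IH) (use Cons.prems in simp)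
  have "\<tau> ` top_vertex ` set (b # bs) = insert (top_vertex c) (\<tau> ` top_vertex ` set bs)"
    using Cons.prems by simp
  then show ?case unfolding IH by simp
qed simp

lemma path_image_sub: "path \<tau> c bs \<Longrightarrow> \<tau> ` top_vertex ` set bs \<subseteq> top_vertex ` set (c # bs)"
  unfolding path_image by (rule image_mono) (rule subsetI, rule in_set_butlastD)

text \<open>The chain is built from its far end. Composing with a transposition sends the top vertex
  of the first column \<open>b\<close> to that of \<open>c\<close>, and distinctness keeps the later
  values intact.\<close>

lemma path_exists:
  assumes "distinct (c # bs)" "set bs \<subseteq> C" "top_vertex c \<in> V"
  shows "\<exists>\<tau>. \<tau> permutes V \<and> path \<tau> c bs"
  using assms
proof (induction bs arbitrary: c)
  case Nil
  then show ?case by (auto intro: permutes_id)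
next
  case (Cons b bs)
  have bV: "top_vertex b \<in> V" using Cons.prems(2) X_sub by auto
  obtain \<tau> where \<tau>: "\<tau> permutes V" "path \<tau> b bs"
    using Cons.IH[of b] Cons.prems bV by auto
  define \<sigma> where "\<sigma> = Transposition.transpose (\<tau> (top_vertex b)) (top_vertex c) \<circ> \<tau>"
  have "\<tau> (top_vertex b) \<in> V" using permutes_in_image[OF \<tau>(1)] bV by simp
  then have "\<sigma> permutes V" unfolding \<sigma>_def
    by (intro permutes_compose[OF \<tau>(1)] permutes_swap_id Cons.prems(3))
  moreover have "path \<sigma> b bs"
  proof (rule path_cong[OF \<tau>(2)])
    fix b' assume b': "b' \<in> set bs"
    have "\<tau> (top_vertex b') \<in> top_vertex ` set (b # bs)"
      by (rule subsetD[OF path_image_sub[OF \<tau>(2)]]) (use b' in blast)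
    then have "\<tau> (top_vertex b') \<noteq> top_vertex c"
      using Cons.prems(1) inj_top by (auto simp: inj_eq)
    moreover have "\<tau> (top_vertex b') \<noteq> \<tau> (top_vertex b)"
      using Cons.prems(1) b' inj_top permutes_inj[OF \<tau>(1)] by (auto simp: inj_eq)
    ultimately show "\<sigma> (top_vertex b') = \<tau> (top_vertex b')" by (simp add: \<sigma>_def transpose_def)
  qed
  moreover have "\<sigma> (top_vertex b) = top_vertex c" by (simp add: \<sigma>_def)
  ultimately show ?case using Cons.prems(2) by auto
qed

section \<open>Forests of row 1 that contain a given chain\<close>

text \<open>In row 1 the chain is traversed backwards, from any of its columns down to the block of
  \<open>c\<close>.\<close>

lemma path_hits_known:
  assumes "path \<tau> c bs" "\<And>b. b \<in> set bs \<Longrightarrow> f b = blk (fst (\<tau> (top_vertex b)))" "hits f A (blk c)"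
    and "b \<in> set bs"
  shows "hits f A (Some b)"
  using assms
proof (induction bs arbitrary: c)
  case (Cons a bs)
  have "f a = blk c" using Cons.prems(1) Cons.prems(2)[of a] by simp
  then have a: "hits f A (Some a)" using Cons.prems(3) by (intro hits_step) simp
  moreover have "blk a = Some a" using Cons.prems(1) blk_C by simp
  ultimately show ?case using Cons.IH[of a] Cons.prems by auto
qed simp

text \<open>These are the vertices in columns marked in row 1; their number is the factor
  \<open>r\<close> of the formula.\<close>

abbreviation root_vertices where "root_vertices \<equiv> {y \<in> V. blk (fst y) = None}"

lemma blk_X: "x \<in> X \<Longrightarrow> \<exists>b\<in>C. x = top_vertex b \<and> blk (fst x) = Some b"
  using blk_C by auto

text \<open>\<open>card_forests\<close> is applied with the critical vertices of the chain
  prescribed. If \<open>c\<close> lies in the root block, the whole chain is rooted; if its block is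
  on the chain, there is a cycle; otherwise the chain ends in an undecided column and only the root
  vertices are rooted.\<close>

lemma card_path_perms:
  assumes bs: "distinct bs" "set bs \<subseteq> C" and c: "c \<in> I" "1 \<le> w c"
  shows "card {\<tau> \<in> row1_perms. path \<tau> c bs} =
    (if blk c = None then card {y \<in> V - X. blk (fst y) \<in> insert None (Some ` set bs)}
     else if blk c \<in> Some ` set bs then 0 else card root_vertices) * fact (card V - length bs - 1)"
proof (cases "blk c \<in> Some ` set bs")
  case True
  then have none: "{\<tau> \<in> row1_perms. path \<tau> c bs} = {}" using path_distinct(2) by blast
  show ?thesis using True unfolding none by auto
next
  case False
  have cV: "top_vertex c \<in> V" using c by (rule top_in_V)
  have c_bs: "c \<notin> set bs" using False bs(2) blk_C by (metis imageI subsetD)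
  then obtain \<tau> where \<tau>: "\<tau> permutes V" "path \<tau> c bs" using path_exists[of c bs] bs cV by auto
  define D where "D = top_vertex ` set bs"
  define f where "f = known top_vertex (\<lambda>x. blk (fst x)) D \<tau>"
  have topD: "top_vertex b \<in> D \<longleftrightarrow> b \<in> set bs" for b
    using inj_top by (auto simp: D_def inj_eq)
  have f: "f b = (if b \<in> set bs then blk (fst (\<tau> (top_vertex b))) else Some b)" for b
    by (simp add: f_def known_def topD)
  have hits_bs: "hits f A (Some b)" if "hits f A (blk c)" "b \<in> set bs" for A b
    using path_hits_known[OF \<tau>(2) _ that] f by simp
  have DV: "D \<subseteq> V" using bs(2) X_sub unfolding D_def by blast
  have "D \<subset> V" using DV topD c_bs cV by blast
  have card_D: "card D = length bs"
    unfolding D_def using bs(1) by (simp add: card_image inj_on_subset[OF inj_top] distinct_card)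
  have \<tau>D: "\<tau> ` D \<subseteq> top_vertex ` set (c # bs)" unfolding D_def by (rule path_image_sub[OF \<tau>(2)])
  have eq: "{\<tau> \<in> row1_perms. path \<tau> c bs} = row1.forests D \<tau>"
  proof -
    have "path \<sigma> c bs \<longleftrightarrow> (\<forall>x\<in>D. \<sigma> x = \<tau> x)" for \<sigma>
    proof
      show "path \<sigma> c bs \<Longrightarrow> \<forall>x\<in>D. \<sigma> x = \<tau> x"
        using path_agree[OF \<tau>(2), of \<sigma>] unfolding D_def by simp
      show "\<forall>x\<in>D. \<sigma> x = \<tau> x \<Longrightarrow> path \<sigma> c bs"
        by (rule path_cong[OF \<tau>(2)]) (simp add: D_def)
    qed
    then show ?thesis
      by (auto simp: row1_perms_def row1.forests_def row_forest_row1)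
  qed
  have acyc: "row1.known_acyclic D \<tau>"
    unfolding row1.known_acyclic_def f_def[symmetric]
  proof
    fix b assume b: "b \<in> C"
    let ?A = "{None} \<union> Some ` {b \<in> C. top_vertex b \<notin> D}"
    show "hits f ?A (Some b)"
    proof (cases "b \<in> set bs")
      case True
      have "blk c \<in> insert None (Some ` C)" using row1.blk_in[OF cV] by simp
      then have "blk c \<in> ?A" using False topD by auto
      then show ?thesis by (rule hits_bs[OF hits_base True])
    next
      case False
      then show ?thesis using b topD by (intro hits_base) simp
    qed
  qed
  have stuck: "\<not> hits f {None} (Some b)" if "b \<notin> set bs" for b
  proof
    assume "hits f {None} (Some b)"
    then have "Some b \<in> {None}" by (rule hits_loop) (simp add: f that)
    then show False by simp
  qed
  have card_rooted: "card (row1.rooted D \<tau>) = (if blk c = None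
      then card {y \<in> V - X. blk (fst y) \<in> insert None (Some ` set bs)} else card root_vertices)"
  proof (cases "blk c = None")
    case True
    define E where "E = {y \<in> V. blk (fst y) \<in> insert None (Some ` set bs)}"
    have hN: "hits f {None} (Some b) \<longleftrightarrow> b \<in> set bs" for b
      using stuck hits_bs[of "{None}" b] True by (auto simp: hits_None_iff)
    have "row1.rooted D \<tau> = E - \<tau> ` D"
    proof (rule set_eqI)
      fix y
      show "y \<in> row1.rooted D \<tau> \<longleftrightarrow> y \<in> E - \<tau> ` D"
        unfolding row1.rooted_def f_def[symmetric] E_def
        by (cases "blk (fst y)") (auto simp: hN hits_None_iff)
    qed
    moreover have "\<tau> ` D \<subseteq> E"
    proof
      fix y assume "y \<in> \<tau> ` D"
      then obtain b where b: "y = top_vertex b" "b \<in> set (c # bs)"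
        using \<tau>D by blast
      then show "y \<in> E" using True cV bs(2) blk_C X_sub by (auto simp: E_def)
    qed
    moreover have "card (\<tau> ` D) = length bs"
      using card_D by (simp add: card_image inj_on_subset[OF permutes_inj[OF \<tau>(1)]])
    ultimately have "card (row1.rooted D \<tau>) = card E - length bs"
      using finite_subset[OF DV fin_V] by (simp add: card_Diff_subset)
    \<comment> \<open>The used targets and the critical vertices of the chain are subsets of
      \<open>E\<close> of the same size \<open>length bs\<close>; removing the latter instead gives
      a set that does not depend on \<open>\<tau>\<close>.\<close>
    also have "\<dots> = card (E - D)"
    proof -
      have "D \<subseteq> E" using DV bs(2) blk_C by (auto simp: D_def E_def)
      then show ?thesis using card_D finite_subset[OF DV fin_V] by (simp add: card_Diff_subset)
    qed
    \<comment> \<open>Within these blocks the critical vertices are exactly those of the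
      chain.\<close>
    also have "E - D = {y \<in> V - X. blk (fst y) \<in> insert None (Some ` set bs)}"
    proof (rule set_eqI)
      fix y
      have "y \<in> X \<longleftrightarrow> y \<in> D" if "blk (fst y) \<in> insert None (Some ` set bs)"
      proof
        assume "y \<in> X"
        then show "y \<in> D" using blk_X[of y] that by (auto simp: D_def)
      qed (use bs(2) in \<open>auto simp: D_def\<close>)
      then show "y \<in> E - D \<longleftrightarrow> y \<in> {y \<in> V - X. blk (fst y) \<in> insert None (Some ` set bs)}"
        unfolding E_def by blast
    qed
    finally show ?thesis using True by simp
  next
    case nN: False
    then obtain a where a: "blk c = Some a" by blast
    with False have a_bs: "a \<notin> set bs" by auto
    have fa: "f a = Some a" using f a_bs by simp
    have hN: "\<not> hits f {None} (Some b)" for b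
    proof (cases "b \<in> set bs")
      case True
      then have "hits f {Some a} (Some b)" using hits_bs[of "{Some a}" b] a by (simp add: hits_base)
      from hits_loop_exclusive[OF this fa] show ?thesis .
    qed (rule stuck)
    \<comment> \<open>The used targets lie in \<open>c\<close> or on the chain, and none of these
      columns is in the root block, so no root vertex is used up.\<close>
    have "y \<notin> \<tau> ` D" if "blk (fst y) = None" for y
    proof
      assume "y \<in> \<tau> ` D"
      then obtain b where "y = top_vertex b" "b \<in> set (c # bs)"
        using \<tau>D by blast
      then show False using that a bs(2) blk_C by auto
    qed
    have "row1.rooted D \<tau> = root_vertices"
    proof (rule set_eqI)
      fix y
      show "y \<in> row1.rooted D \<tau> \<longleftrightarrow> y \<in> root_vertices"
        unfolding row1.rooted_def f_def[symmetric]
        using \<open>\<And>y. blk (fst y) = None \<Longrightarrow> y \<notin> \<tau> ` D\<close>[of y]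
        by (cases "blk (fst y)") (auto simp: hN hits_None_iff)
    qed
    with a show ?thesis by simp
  qed
  have "card (V - D) = card V - length bs"
    using card_Diff_subset[OF finite_subset[OF DV fin_V] DV] card_D by simp
  then show ?thesis
    using row1.card_forests[OF \<tau>(1) \<open>D \<subset> V\<close> acyc] False unfolding eq card_rooted by simp
qed

text \<open>Let \<open>Z\<close> be the noncritical vertices in the root block or in a block of the
  chain, and let \<open>q\<close> be the number of root vertices. Each root vertex contributes
  \<open>|Z|\<close>, the rest of \<open>Z\<close> nothing, and each of the
  \<open>|V - X| - |Z|\<close> other vertices \<open>q\<close>; up to the common factorial the total
  is \<open>q |V - X|\<close>.\<close>

lemma sum_path_perms:
  assumes bs: "distinct bs" "set bs \<subseteq> C"
  shows "(\<Sum>x\<in>V - X. card {\<tau> \<in> row1_perms. path \<tau> (fst x) bs}) =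
    card root_vertices * (card V - card C) * fact (card V - length bs - 1)"
proof -
  define F where "F = (fact (card V - length bs - 1) :: nat)"
  define Z where "Z = {y \<in> V - X. blk (fst y) \<in> insert None (Some ` set bs)}"
  have finVX: "finite (V - X)" using fin_V by simp
  have "Z \<subseteq> V - X" by (auto simp: Z_def)
  then have card_Z: "card Z \<le> card (V - X)" by (rule card_mono[OF finVX])
  have rv: "root_vertices \<subseteq> Z" using blk_X by (fastforce simp: Z_def)
  have "(\<Sum>x\<in>V - X. card {\<tau> \<in> row1_perms. path \<tau> (fst x) bs}) =
    (\<Sum>x\<in>V - X. if x \<in> root_vertices then card Z * F else if x \<in> Z then 0 else card root_vertices * F)"
  proof (rule sum.cong[OF refl])
    fix x assume x: "x \<in> V - X"
    then have "fst x \<in> I" "1 \<le> w (fst x)" by (auto simp: V_def)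
    from card_path_perms[OF bs this] x
    show "card {\<tau> \<in> row1_perms. path \<tau> (fst x) bs} =
      (if x \<in> root_vertices then card Z * F else if x \<in> Z then 0 else card root_vertices * F)"
      unfolding F_def[symmetric] Z_def[symmetric] by (auto simp: Z_def)
  qed
  also have "\<dots> = card root_vertices * (card Z * F) + card (V - X - Z) * (card root_vertices * F)"
  proof -
    have "(V - X) \<inter> root_vertices = root_vertices" "(V - X) \<inter> - root_vertices \<inter> - Z = V - X - Z"
      using rv by (auto simp: Z_def)
    then show ?thesis using finVX by (simp add: sum.If_cases del: mem_Collect_eq)
  qed
  also have "card (V - X - Z) = card (V - X) - card Z"
    by (intro card_Diff_subset finite_subset[OF _ finVX]) (auto simp: Z_def)
  also have "card root_vertices * (card Z * F) + (card (V - X) - card Z) * (card root_vertices * F)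
      = card root_vertices * (card Z + (card (V - X) - card Z)) * F"
    by (simp add: algebra_simps)
  also have "card Z + (card (V - X) - card Z) = card (V - X)"
    using card_Z by (rule le_add_diff_inverse)
  also have "card (V - X) = card V - card C"
    using card_Diff_subset[OF finite_subset[OF X_sub fin_V] X_sub] card_X by simp
  finally show ?thesis by (simp add: F_def)
qed

section \<open>Counting pairs of forests\<close>

text \<open>Every counted \<open>S\<close> is first met at the end of exactly one chain. Given the
  chain, \<open>S\<close> contains the last column of \<open>c # bs\<close> and avoids the
  \<open>length bs\<close> columns before it.\<close>

lemma card_first_hits:
  assumes \<tau>: "\<tau> \<in> row1_perms" and c: "c \<in> I" and k: "1 \<le> k"
  shows "card {S \<in> {S. S \<subseteq> I \<and> card S = k}. hits (chain_step S \<tau>) {None} (blk2 S c)}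
    = (\<Sum>bs\<in>{bs. (distinct bs \<and> set bs \<subseteq> C) \<and> path \<tau> c bs}. (card I - length bs - 1) choose (k - 1))"
proof -
  have \<tau>p: "\<tau> permutes V" using \<tau> by (simp add: row1_perms_def)
  let ?P = "{bs. (distinct bs \<and> set bs \<subseteq> C) \<and> path \<tau> c bs}"
  let ?H = "\<lambda>bs. {S. S \<subseteq> I \<and> card S = k \<and> first_hit S c bs}"
  have finP: "finite ?P"
    by (rule finite_subset[OF _ finite_subset_distinct[OF fin_C]]) auto
  have "{S \<in> {S. S \<subseteq> I \<and> card S = k}. hits (chain_step S \<tau>) {None} (blk2 S c)} = (\<Union>bs\<in>?P. ?H bs)"
  proof (intro set_eqI iffI)
    fix S assume S: "S \<in> {S \<in> {S. S \<subseteq> I \<and> card S = k}. hits (chain_step S \<tau>) {None} (blk2 S c)}"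
    then obtain bs where bs: "path \<tau> c bs" "first_hit S c bs"
      using hits_path[OF _ refl \<tau>p] by blast
    then have "bs \<in> ?P" using path_distinct(1)[OF \<tau>] path_C by simp
    with S bs(2) show "S \<in> (\<Union>bs\<in>?P. ?H bs)" by blast
  next
    fix S assume "S \<in> (\<Union>bs\<in>?P. ?H bs)"
    then show "S \<in> {S \<in> {S. S \<subseteq> I \<and> card S = k}. hits (chain_step S \<tau>) {None} (blk2 S c)}"
      using path_hits[OF \<tau>p] by blast
  qed
  also have "card \<dots> = (\<Sum>bs\<in>?P. card (?H bs))"
  proof (rule card_UN_disjoint[OF finP])
    show "\<forall>bs\<in>?P. finite (?H bs)"
      using fin_I by (auto intro: finite_subset[of _ "Pow I"])
    show "\<forall>bs\<in>?P. \<forall>bs'\<in>?P. bs \<noteq> bs' \<longrightarrow> ?H bs \<inter> ?H bs' = {}"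
      using first_hit_unique[OF \<tau>p] by blast
  qed
  also have "\<dots> = (\<Sum>bs\<in>?P. (card I - length bs - 1) choose (k - 1))"
  proof (rule sum.cong[OF refl])
    fix bs assume "bs \<in> ?P"
    then have bs: "path \<tau> c bs" "set bs \<subseteq> C" by auto
    have dist: "distinct (c # bs)" by (rule path_distinct(1)[OF \<tau> bs(1)])
    have sub: "set (c # bs) \<subseteq> I" using bs(2) c by (auto simp: crit_cols_def)
    have db: "distinct (butlast (c # bs) @ [last (c # bs)])"
      using dist append_butlast_last_id[of "c # bs"] by (metis list.distinct(1))
    have "?H bs = {S. S \<subseteq> I \<and> card S = k \<and> last (c # bs) \<in> S \<and> set (butlast (c # bs)) \<inter> S = {}}"
      by (auto simp: first_hit_def)
    also have "card \<dots> = (card I - card (set (butlast (c # bs))) - 1) choose (k - 1)"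
    proof (rule card_subsets_first_hit[OF fin_I _ _ _ k])
      show "last (c # bs) \<in> I" using sub last_in_set[of "c # bs"] by blast
      show "set (butlast (c # bs)) \<subseteq> I" using sub in_set_butlastD[of _ "c # bs"] by blast
      show "last (c # bs) \<notin> set (butlast (c # bs))" using db by (simp only: distinct_append) simp
    qed
    also have "card (set (butlast (c # bs))) = length bs"
      using db distinct_card[of "butlast (c # bs)"] by (simp only: distinct_append length_butlast) simp
    finally show "card (?H bs) = (card I - length bs - 1) choose (k - 1)" .
  qed
  finally show ?thesis .
qed

text \<open>Every permutation contains the empty chain at \<open>c\<close>, and the block of
  \<open>c\<close> is neither the root nor on that chain.\<close>

lemma card_row1_perms:
  assumes "c \<in> C"
  shows "card row1_perms = card root_vertices * fact (card V - 1)"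
  using card_path_perms[of "[]" c] assms blk_C[OF assms] by (auto simp: crit_cols_def)

text \<open>Summing the double count over \<open>S\<close> and exchanging sums puts the chains
  outermost. A chain of length \<open>A\<close> contributes a binomial coefficient from the choice
  of \<open>S\<close> and a factorial from row 1; the product is the falling factorial counting
  sequences of \<open>A\<close> distinct critical columns.\<close>

theorem card_pairs:
  assumes V: "V \<noteq> {}" and k: "1 \<le> k"
  shows "card (SIGMA S:{S. S \<subseteq> I \<and> card S = k}. {\<sigma> \<in> row1_perms. row_forest S Map.empty (inv \<sigma>)})
    = card root_vertices * (\<Sum>A\<le>card C. \<Prod>{card C - A + 1..card C} *
        ((card I - A - 1) choose (k - 1)) * fact (card V - A - 1))"
    (is "card ?P = card root_vertices * ?sum")
proof (cases "card C < card V")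
  \<comment> \<open>All vertices are critical, hence none lies in a marked column of row 1; then row
    1 admits no forest and both sides vanish.\<close>
  case False
  then have XV: "X = V" using card_subset_eq[OF fin_V X_sub] card_X card_mono[OF fin_V X_sub] by simp
  with V obtain c where "c \<in> C" by blast
  have "root_vertices = {}" using blk_X XV by fastforce
  then have rv: "card root_vertices = 0" by (simp only: card.empty)
  have "card row1_perms = 0" unfolding card_row1_perms[OF \<open>c \<in> C\<close>] rv by simp
  then have "row1_perms = {}" using fin_row1_perms by simp
  then show ?thesis unfolding rv by simp
next
  case True
  define m where "m = card V - card C"
  define \<S> where "\<S> = {S. S \<subseteq> I \<and> card S = k}"
  define L where "L = {bs. distinct bs \<and> set bs \<subseteq> C}"
  define g where "g bs = (card I - length bs - 1) choose (k - 1)" for bs :: "nat list"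
  have fin\<S>: "finite \<S>" unfolding \<S>_def using fin_I by simp
  have finL: "finite L"
    unfolding L_def using finite_subset_distinct[OF fin_C] by (simp add: conj_commute)
  have finVX: "finite (V - X)" using fin_V by simp
  \<comment> \<open>Both sides are compared after multiplication by \<open>m\<close>, which is
    positive and cancels at the end.\<close>
  have "m * card ?P = (\<Sum>S\<in>\<S>. m * card {\<sigma> \<in> row1_perms. row_forest S Map.empty (inv \<sigma>)})"
    unfolding \<S>_def[symmetric] using fin\<S> fin_row1_perms by (simp add: sum_distrib_left)
  also have "\<dots> = (\<Sum>S\<in>\<S>. \<Sum>\<tau>\<in>row1_perms.
      card {x \<in> V - X. hits (chain_step S \<tau>) {None} (blk2 S (fst x))})"
    unfolding m_def by (simp add: double_count_row2[OF True])
  also have "\<dots> = (\<Sum>\<tau>\<in>row1_perms. \<Sum>S\<in>\<S>.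
      card {x \<in> V - X. hits (chain_step S \<tau>) {None} (blk2 S (fst x))})"
    by (rule sum.swap)
  also have "\<dots> = (\<Sum>\<tau>\<in>row1_perms. \<Sum>x\<in>V - X.
      card {S \<in> \<S>. hits (chain_step S \<tau>) {None} (blk2 S (fst x))})"
    by (intro sum.cong refl sum_multicount_gen fin\<S> finVX) simp
  also have "\<dots> = (\<Sum>\<tau>\<in>row1_perms. \<Sum>x\<in>V - X. \<Sum>bs\<in>L. if path \<tau> (fst x) bs then g bs else 0)"
  proof (intro sum.cong refl)
    fix \<tau> x assume \<tau>: "\<tau> \<in> row1_perms" and x: "x \<in> V - X"
    have "card {S \<in> \<S>. hits (chain_step S \<tau>) {None} (blk2 S (fst x))}
        = (\<Sum>bs\<in>{bs \<in> L. path \<tau> (fst x) bs}. g bs)"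
      using card_first_hits[OF \<tau> _ k, of "fst x"] x unfolding \<S>_def L_def g_def V_def by auto
    also have "\<dots> = (\<Sum>bs\<in>L. if path \<tau> (fst x) bs then g bs else 0)"
      by (rule sum.inter_filter[OF finL])
    finally show "card {S \<in> \<S>. hits (chain_step S \<tau>) {None} (blk2 S (fst x))}
      = (\<Sum>bs\<in>L. if path \<tau> (fst x) bs then g bs else 0)" .
  qed
  also have "\<dots> = (\<Sum>\<tau>\<in>row1_perms. \<Sum>bs\<in>L. \<Sum>x\<in>V - X. if path \<tau> (fst x) bs then g bs else 0)"
    by (intro sum.cong refl sum.swap)
  also have "\<dots> = (\<Sum>bs\<in>L. \<Sum>\<tau>\<in>row1_perms. \<Sum>x\<in>V - X. if path \<tau> (fst x) bs then g bs else 0)"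
    by (rule sum.swap)
  also have "\<dots> = (\<Sum>bs\<in>L. \<Sum>x\<in>V - X. \<Sum>\<tau>\<in>row1_perms. if path \<tau> (fst x) bs then g bs else 0)"
    by (intro sum.cong refl sum.swap)
  also have "\<dots> = (\<Sum>bs\<in>L. (\<Sum>x\<in>V - X. card {\<tau> \<in> row1_perms. path \<tau> (fst x) bs}) * g bs)"
    using fin_row1_perms by (simp add: sum.inter_filter[symmetric] sum_distrib_right)
  also have "\<dots> = (\<Sum>bs\<in>L. card root_vertices * m * fact (card V - length bs - 1) * g bs)"
    by (intro sum.cong refl) (simp add: sum_path_perms L_def m_def)
  \<comment> \<open>The summand depends on the chain only through its length, which is at most the
    number of critical columns.\<close>
  also have "\<dots> = (\<Sum>A\<le>card C. \<Sum>bs\<in>{bs\<in>L. length bs = A}.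
      card root_vertices * m * fact (card V - length bs - 1) * g bs)"
  proof (rule sum.group[symmetric])
    show "length ` L \<subseteq> {..card C}"
      using card_mono[OF fin_C] by (force simp: L_def distinct_card[symmetric])
  qed (use finL in auto)
  also have "\<dots> = (\<Sum>A\<le>card C. card {bs\<in>L. length bs = A} *
      (card root_vertices * m * fact (card V - A - 1) * ((card I - A - 1) choose (k - 1))))"
    by (intro sum.cong refl) (simp add: g_def)
  also have "\<dots> = (\<Sum>A\<le>card C. \<Prod>{card C - A + 1..card C} *
      (card root_vertices * m * fact (card V - A - 1) * ((card I - A - 1) choose (k - 1))))"
  proof (rule sum.cong[OF refl])
    fix A assume "A \<in> {..card C}"
    moreover have "{bs \<in> L. length bs = A} = {bs. length bs = A \<and> distinct bs \<and> set bs \<subseteq> C}"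
      by (auto simp: L_def)
    ultimately show "card {bs \<in> L. length bs = A} *
        (card root_vertices * m * fact (card V - A - 1) * ((card I - A - 1) choose (k - 1)))
      = \<Prod>{card C - A + 1..card C} *
        (card root_vertices * m * fact (card V - A - 1) * ((card I - A - 1) choose (k - 1)))"
      using card_lists_distinct_length_eq[OF fin_C, of A] by simp
  qed
  also have "\<dots> = m * (card root_vertices * ?sum)"
    by (simp add: sum_distrib_left mult_ac)
  finally show ?thesis using True by (simp add: m_def)
qed

section \<open>Arrays as permutations\<close>

definition row_psi :: "nat set \<Rightarrow> (nat \<rightharpoonup> nat) \<Rightarrow> (nat \<times> nat \<Rightarrow> nat \<times> nat) \<Rightarrow> nat \<rightharpoonup> nat" where
  "row_psi Q f \<sigma> j =
     (if j \<in> Q then None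
      else if j \<in> dom f then f j
      else if j \<in> I \<and> 1 \<le> w j then Some (fst (\<sigma> (top_vertex j)))
      else None)"

text \<open>A walk in the merged graph lifts to a walk of columns: at a column with an arrow, the
  arrow hidden by merging is followed first.\<close>

lemma hits_row_psi:
  assumes "hits (\<lambda>b. block Q f (fst (\<sigma> (top_vertex b)))) {None} z"
    and "\<sigma> permutes V"
    and f: "\<And>j k. f j = Some k \<Longrightarrow> k \<in> I \<and> k \<notin> Q \<and> k \<notin> dom f \<and> 1 \<le> w k"
    and "z = block Q f j" "j \<in> I \<and> 1 \<le> w j \<or> j \<in> dom f"
  shows "\<exists>k\<in>Q. (j, k) \<in> (Map.graph (row_psi Q f \<sigma>))\<^sup>*"
  using assms(1,4,5)
proof (induction arbitrary: j rule: hits.induct)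
  case (hits_base z)
  then have "j \<in> Q" by (auto simp: block_def split: if_splits)
  then show ?case by blast
next
  case (hits_step b)
  have jQ: "j \<notin> Q" using hits_step.prems by (auto simp: block_def)
  have b: "b \<in> I" "1 \<le> w b" "b \<notin> Q" "b \<notin> dom f"
    and jb: "(j, b) \<in> (Map.graph (row_psi Q f \<sigma>))\<^sup>*"
  proof -
    have "b \<in> I \<and> 1 \<le> w b \<and> b \<notin> Q \<and> b \<notin> dom f \<and> (j, b) \<in> (Map.graph (row_psi Q f \<sigma>))\<^sup>*"
    proof (cases "j \<in> dom f")
      case True
      then have fj: "f j = Some b" using hits_step.prems jQ by (simp add: block_def)
      then have "(j, b) \<in> Map.graph (row_psi Q f \<sigma>)"
        using True jQ by (simp add: row_psi_def Map.graph_def)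
      with f[OF fj] show ?thesis by blast
    next
      case False
      then have "b = j" using hits_step.prems jQ by (simp add: block_def)
      with False jQ hits_step.prems(2) show ?thesis by blast
    qed
    then show "b \<in> I" "1 \<le> w b" "b \<notin> Q" "b \<notin> dom f"
      "(j, b) \<in> (Map.graph (row_psi Q f \<sigma>))\<^sup>*" by blast+
  qed
  have "\<sigma> (top_vertex b) \<in> V"
    using permutes_in_image[OF assms(2)] top_in_V[OF b(1,2)] by simp
  then have "fst (\<sigma> (top_vertex b)) \<in> I" "1 \<le> w (fst (\<sigma> (top_vertex b)))" by (auto simp: V_def)
  then obtain k where k: "k \<in> Q" "(fst (\<sigma> (top_vertex b)), k) \<in> (Map.graph (row_psi Q f \<sigma>))\<^sup>*"
    using hits_step.IH[OF refl] by blast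
  have "(b, fst (\<sigma> (top_vertex b))) \<in> Map.graph (row_psi Q f \<sigma>)"
    using b by (simp add: row_psi_def Map.graph_def)
  with jb k(2) have "(j, k) \<in> (Map.graph (row_psi Q f \<sigma>))\<^sup>*"
    by (meson converse_rtrancl_into_rtrancl rtrancl_trans)
  with k(1) show ?case by blast
qed

text \<open>A step along an arrow stays in the same block, and any other step is an edge of the
  merged graph.\<close>

lemma row_psi_hits:
  assumes "(j, k) \<in> (Map.graph (row_psi Q f \<sigma>))\<^sup>*" "k \<in> Q"
    and f: "\<And>j k. f j = Some k \<Longrightarrow> k \<in> I \<and> k \<notin> Q \<and> k \<notin> dom f \<and> 1 \<le> w k"
  shows "hits (\<lambda>b. block Q f (fst (\<sigma> (top_vertex b)))) {None} (block Q f j)"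
  using assms(1)
proof (induction rule: converse_rtrancl_induct)
  case base
  then show ?case using assms(2) by (simp add: block_def hits_base)
next
  case (step j j')
  have p: "row_psi Q f \<sigma> j = Some j'" using step.hyps(1) by (simp add: Map.graph_def)
  then have jQ: "j \<notin> Q" by (auto simp: row_psi_def)
  show ?case
  proof (cases "j \<in> dom f")
    case True
    then have fj: "f j = Some j'" using p jQ by (simp add: row_psi_def)
    then have "block Q f j = block Q f j'" using f[OF fj] True jQ by (simp add: block_def)
    with step.IH show ?thesis by simp
  next
    case False
    then have "j' = fst (\<sigma> (top_vertex j))" using p jQ by (auto simp: row_psi_def split: if_splits)
    with step.IH have "hits (\<lambda>b. block Q f (fst (\<sigma> (top_vertex b)))) {None} (Some j)"
      by (intro hits_step) simp
    with False jQ show ?thesis by (simp add: block_def)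
  qed
qed

lemma row_forest_iff_psi:
  assumes "\<sigma> permutes V" "dom f \<inter> Q = {}"
    and f: "\<And>j k. f j = Some k \<Longrightarrow> k \<in> I \<and> k \<notin> Q \<and> k \<notin> dom f \<and> 1 \<le> w k"
  shows "(\<forall>j\<in>dom (row_psi Q f \<sigma>). \<exists>t\<ge>1. \<exists>k\<in>Q. (j, k) \<in> Map.graph (row_psi Q f \<sigma>) ^^ t)
    \<longleftrightarrow> row_forest Q f \<sigma>"
proof -
  let ?G = "Map.graph (row_psi Q f \<sigma>)"
  have pow: "(\<exists>t\<ge>1. \<exists>k\<in>Q. (j, k) \<in> ?G ^^ t) \<longleftrightarrow> (\<exists>k\<in>Q. (j, k) \<in> ?G\<^sup>*)"
    if "j \<in> dom (row_psi Q f \<sigma>)" for j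
  proof
    have jQ: "j \<notin> Q" using that by (auto simp: row_psi_def)
    assume "\<exists>k\<in>Q. (j, k) \<in> ?G\<^sup>*"
    then obtain k t where k: "k \<in> Q" "(j, k) \<in> ?G ^^ t" using rtrancl_power by blast
    \<comment> \<open>A column in the domain is unmarked, so a walk to a marked column has at least
      one step.\<close>
    then have "t \<noteq> 0" using jQ by (cases t) auto
    with k show "\<exists>t\<ge>1. \<exists>k\<in>Q. (j, k) \<in> ?G ^^ t" by (intro exI[of _ t]) auto
  qed (use rtrancl_power in blast)
  show ?thesis
  proof
    assume L: "\<forall>j\<in>dom (row_psi Q f \<sigma>). \<exists>t\<ge>1. \<exists>k\<in>Q. (j, k) \<in> ?G ^^ t"
    show "row_forest Q f \<sigma>"
      unfolding row_forest_def
    proof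
      fix b assume b: "b \<in> crit_cols Q f"
      then have "b \<in> dom (row_psi Q f \<sigma>)" by (auto simp: crit_cols_def row_psi_def)
      then obtain k where "k \<in> Q" "(b, k) \<in> ?G\<^sup>*" using L pow by blast
      from row_psi_hits[OF this(2,1) f] b
      show "hits (\<lambda>b. block Q f (fst (\<sigma> (top_vertex b)))) {None} (Some b)"
        by (simp add: block_def crit_cols_def)
    qed
  next
    assume R: "row_forest Q f \<sigma>"
    show "\<forall>j\<in>dom (row_psi Q f \<sigma>). \<exists>t\<ge>1. \<exists>k\<in>Q. (j, k) \<in> ?G ^^ t"
    proof
      fix j assume j: "j \<in> dom (row_psi Q f \<sigma>)"
      have jQ: "j \<notin> Q" using j by (auto simp: row_psi_def)
      have jd: "j \<in> I \<and> 1 \<le> w j \<or> j \<in> dom f" using j by (auto simp: row_psi_def split: if_splits)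
      \<comment> \<open>A column with an arrow may be empty; its condition is that of the target of
        the arrow.\<close>
      have "\<exists>b\<in>crit_cols Q f. block Q f j = Some b"
      proof (cases "j \<in> dom f")
        case True
        then obtain k where k: "f j = Some k" by blast
        from f[OF k] k True jQ show ?thesis by (auto simp: crit_cols_def block_def)
      next
        case False
        with jd jQ show ?thesis by (auto simp: crit_cols_def block_def)
      qed
      then have "hits (\<lambda>b. block Q f (fst (\<sigma> (top_vertex b)))) {None} (block Q f j)"
        using R by (auto simp: row_forest_def)
      then have "\<exists>k\<in>Q. (j, k) \<in> ?G\<^sup>*"
        by (rule hits_row_psi[OF _ assms(1) f refl jd])
      with pow[OF j] show "\<exists>t\<ge>1. \<exists>k\<in>Q. (j, k) \<in> ?G ^^ t" by blast
    qed
  qed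
qed

section \<open>Encoding arrays by a marked set and a permutation\<close>

definition cell_count :: "row \<Rightarrow> nat \<Rightarrow> nat" where
  "cell_count i j = (if j \<in> I then w j else 0)"

definition perm_pairing :: "(nat \<times> nat \<Rightarrow> nat \<times> nat) \<Rightarrow> vertex set set" where
  "perm_pairing \<sigma> = (\<lambda>v. {(Row1, v), (Row2, \<sigma> v)}) ` V"

definition perm_array :: "nat set \<Rightarrow> (nat \<times> nat \<Rightarrow> nat \<times> nat) \<Rightarrow> varray" where
  "perm_array S \<sigma> = \<lparr>cnt = cell_count, marked = case_row R S, pairing = perm_pairing \<sigma>\<rparr>"

lemma perm_array_sel [simp]:
  "cnt (perm_array S \<sigma>) = cell_count" "pairing (perm_array S \<sigma>) = perm_pairing \<sigma>"
  "marked (perm_array S \<sigma>) Row1 = R" "marked (perm_array S \<sigma>) Row2 = S"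
  by (simp_all add: perm_array_def)

lemma row_vertices_cell_count: "cnt \<alpha> = cell_count \<Longrightarrow> row_vertices \<alpha> i = Pair i ` V"
  by (auto simp: row_vertices_def cell_count_def V_def image_iff split: if_splits)

lemma perm_pairing_mem:
  "{(Row1, v), (Row2, u)} \<in> perm_pairing \<sigma> \<longleftrightarrow> v \<in> V \<and> u = \<sigma> v"
  by (auto simp: perm_pairing_def doubleton_eq_iff)

lemma perm_pairing_no_loop: "{(i, v), (i, u)} \<notin> perm_pairing \<sigma>"
  by (cases i) (auto simp: perm_pairing_def doubleton_eq_iff)

lemma partner_Row1:
  assumes "v \<in> V" "pairing \<alpha> = perm_pairing \<sigma>"
  shows "partner \<alpha> (Row1, v) = (Row2, \<sigma> v)"
  unfolding partner_def assms(2)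
proof (rule the_equality)
  show "(Row2, \<sigma> v) \<noteq> (Row1, v) \<and> {(Row1, v), (Row2, \<sigma> v)} \<in> perm_pairing \<sigma>"
    using assms(1) perm_pairing_mem by simp
  fix u assume u: "u \<noteq> (Row1, v) \<and> {(Row1, v), u} \<in> perm_pairing \<sigma>"
  obtain i x where ix: "u = (i, x)" by (cases u)
  show "u = (Row2, \<sigma> v)"
    using u perm_pairing_mem[of v x \<sigma>] perm_pairing_no_loop[of Row1 v x \<sigma>] unfolding ix by (cases i) auto
qed

lemma partner_Row2:
  assumes "v \<in> V" "pairing \<alpha> = perm_pairing \<sigma>" "\<sigma> permutes V"
  shows "partner \<alpha> (Row2, v) = (Row1, inv \<sigma> v)"
  unfolding partner_def assms(2)
proof (rule the_equality)
  have "{(Row1, inv \<sigma> v), (Row2, v)} \<in> perm_pairing \<sigma>"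
    using assms(1) permutes_in_image[OF permutes_inv[OF assms(3)], of v]
      permutes_inverses(1)[OF assms(3), of v] perm_pairing_mem by simp
  then show "(Row1, inv \<sigma> v) \<noteq> (Row2, v) \<and> {(Row2, v), (Row1, inv \<sigma> v)} \<in> perm_pairing \<sigma>"
    by (simp add: insert_commute)
  fix u assume u: "u \<noteq> (Row2, v) \<and> {(Row2, v), u} \<in> perm_pairing \<sigma>"
  obtain i x where ix: "u = (i, x)" by (cases u)
  show "u = (Row1, inv \<sigma> v)"
  proof (cases i)
    case Row1
    then have "v = \<sigma> x" using u perm_pairing_mem[of x v \<sigma>] unfolding ix by (simp add: insert_commute)
    then show ?thesis using Row1 ix permutes_inverses(2)[OF assms(3), of x] by simp
  next
    case Row2
    then show ?thesis using u perm_pairing_no_loop[of Row2 v x \<sigma>] unfolding ix by simp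
  qed
qed

lemma perm_pairing_partition:
  assumes "\<sigma> permutes V"
  shows "partition_on (Pair Row1 ` V \<union> Pair Row2 ` V) (perm_pairing \<sigma>)"
proof (rule partition_onI)
  have "(\<Union>v\<in>V. {(Row2, \<sigma> v)}) = Pair Row2 ` V"
    using permutes_image[OF assms] by auto
  moreover have "\<Union> (perm_pairing \<sigma>) = Pair Row1 ` V \<union> (\<Union>v\<in>V. {(Row2, \<sigma> v)})"
    by (auto simp: perm_pairing_def)
  ultimately show "\<Union> (perm_pairing \<sigma>) = Pair Row1 ` V \<union> Pair Row2 ` V" by simp
  show "disjnt p q" if "p \<in> perm_pairing \<sigma>" "q \<in> perm_pairing \<sigma>" "p \<noteq> q" for p q
    using that permutes_inj[OF assms] by (auto simp: perm_pairing_def disjnt_def inj_eq)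
qed (auto simp: perm_pairing_def)

text \<open>Each vertex of row 1 lies in exactly one pair, whose other vertex defines
  \<open>\<sigma>\<close>; disjointness of the pairs gives injectivity, and finiteness
  surjectivity.\<close>

lemma pairing_is_perm:
  assumes part: "partition_on (Pair Row1 ` V \<union> Pair Row2 ` V) P"
    and two: "\<And>B. B \<in> P \<Longrightarrow> \<exists>u\<in>Pair Row1 ` V. \<exists>v\<in>Pair Row2 ` V. B = {u, v}"
  obtains \<sigma> where "\<sigma> permutes V" "P = perm_pairing \<sigma>"
proof -
  have same: "B = B'" if "B \<in> P" "B' \<in> P" "x \<in> B" "x \<in> B'" for B B' x
    using disjointD[OF partition_onD2[OF part] that(1,2)] that(3,4) by blast
  have ex: "\<exists>u\<in>V. {(Row1, v), (Row2, u)} \<in> P" if "v \<in> V" for v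
  proof -
    have "(Row1, v) \<in> \<Union> P" using part that by (auto simp: partition_on_def)
    then obtain B where B: "B \<in> P" "(Row1, v) \<in> B" by blast
    from two[OF B(1)] obtain a b where "a \<in> V" "b \<in> V" "B = {(Row1, a), (Row2, b)}" by blast
    with B show ?thesis by auto
  qed
  \<comment> \<open>\<open>permutes\<close> demands the identity outside \<open>V\<close>.\<close>
  define \<sigma> where "\<sigma> v = (if v \<in> V then SOME u. u \<in> V \<and> {(Row1, v), (Row2, u)} \<in> P else v)" for v
  have \<sigma>: "\<sigma> v \<in> V" "{(Row1, v), (Row2, \<sigma> v)} \<in> P" if "v \<in> V" for v
    using someI_ex[of "\<lambda>u. u \<in> V \<and> {(Row1, v), (Row2, u)} \<in> P"] ex[OF that] that
    by (auto simp: \<sigma>_def)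
  have "inj_on \<sigma> V"
  proof
    fix v v' assume v: "v \<in> V" "v' \<in> V" "\<sigma> v = \<sigma> v'"
    have "{(Row1, v), (Row2, \<sigma> v)} = {(Row1, v'), (Row2, \<sigma> v')}"
      by (rule same[OF \<sigma>(2)[OF v(1)] \<sigma>(2)[OF v(2)], of "(Row2, \<sigma> v)"]) (simp_all add: v(3))
    then show "v = v'" by (auto simp: doubleton_eq_iff)
  qed
  moreover have "\<sigma> ` V \<subseteq> V" using \<sigma>(1) by blast
  ultimately have "bij_betw \<sigma> V V"
    using endo_inj_surj[OF fin_V] by (simp add: bij_betw_def)
  then have perm: "\<sigma> permutes V" by (rule bij_imp_permutes) (simp add: \<sigma>_def)
  have "P = perm_pairing \<sigma>"
  proof
    show "perm_pairing \<sigma> \<subseteq> P" using \<sigma>(2) by (auto simp: perm_pairing_def)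
    show "P \<subseteq> perm_pairing \<sigma>"
    proof
      fix B assume B: "B \<in> P"
      from two[OF B] obtain a b where ab: "a \<in> V" "b \<in> V" "B = {(Row1, a), (Row2, b)}" by blast
      then have "B = {(Row1, a), (Row2, \<sigma> a)}"
        by (intro same[OF B \<sigma>(2)[OF ab(1)], of "(Row1, a)"]) auto
      with ab(1) show "B \<in> perm_pairing \<sigma>" by (auto simp: perm_pairing_def)
    qed
  qed
  with perm that show ?thesis by blast
qed

lemma psi_Row1:
  assumes "pairing \<alpha> = perm_pairing \<sigma>" "cnt \<alpha> = cell_count" "marked \<alpha> Row1 = R"
  shows "psi \<alpha> \<phi> Row1 = row_psi R \<phi> \<sigma>"
proof
  fix j
  have "vcol (partner \<alpha> (Row1, j, w j)) = fst (\<sigma> (top_vertex j))" if "j \<in> I" "1 \<le> w j"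
    using partner_Row1[OF top_in_V[OF that] assms(1)] by (simp add: vcol_def top_vertex_def)
  then show "psi \<alpha> \<phi> Row1 j = row_psi R \<phi> \<sigma> j"
    by (auto simp: psi_def row_psi_def assms cell_count_def)
qed

lemma psi_Row2:
  assumes "pairing \<alpha> = perm_pairing \<sigma>" "cnt \<alpha> = cell_count" "marked \<alpha> Row2 = S" "\<sigma> permutes V"
  shows "psi \<alpha> \<phi> Row2 = row_psi S Map.empty (inv \<sigma>)"
proof
  fix j
  have "vcol (partner \<alpha> (Row2, j, w j)) = fst (inv \<sigma> (top_vertex j))" if "j \<in> I" "1 \<le> w j"
    using partner_Row2[OF top_in_V[OF that] assms(1,4)] by (simp add: vcol_def top_vertex_def)
  then show "psi \<alpha> \<phi> Row2 j = row_psi S Map.empty (inv \<sigma>) j"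
    by (auto simp: psi_def row_psi_def assms cell_count_def)
qed

lemma forest_condition_iff:
  assumes "\<sigma> permutes V" "pairing \<alpha> = perm_pairing \<sigma>" "cnt \<alpha> = cell_count"
    "marked \<alpha> Row1 = R" "marked \<alpha> Row2 = S"
  shows "forest_condition \<alpha> \<phi> \<longleftrightarrow> row_forest R \<phi> \<sigma> \<and> row_forest S Map.empty (inv \<sigma>)"
proof -
  have all_row: "(\<forall>i. Q i) \<longleftrightarrow> Q Row1 \<and> Q Row2" for Q using row.exhaust by metis
  have "dom \<phi> \<inter> R = {}" using dom_sub by blast
  from row_forest_iff_psi[OF assms(1) this arrow]
    row_forest_iff_psi[OF permutes_inv[OF assms(1)], of Map.empty S]
  show ?thesis
    unfolding forest_condition_def all_row psi_Row1[OF assms(2-4)] psi_Row2[OF assms(2,3,5,1)] assms(4,5)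
    by simp
qed

lemma card_V: "card V = (\<Sum>j\<in>I. w j)"
  unfolding V_def using fin_I by simp

lemma card_root_vertices: "card root_vertices = (\<Sum>j\<in>R. w j)"
proof -
  have "root_vertices = Sigma R (\<lambda>j. {1..w j})"
    using R_sub by (auto simp: V_def block_def split: if_splits)
  then show ?thesis using finite_subset[OF R_sub fin_I] by simp
qed

lemma num_critical_eq: "I = {1..K} \<Longrightarrow> num_critical K w R \<phi> = card C"
  unfolding num_critical_def crit_cols_def by (intro arg_cong[of _ _ card]) auto

text \<open>Within the substructure the cell counts, the marks of row 1 and the arrows are fixed, so
  an array amounts to its marked set \<open>S\<close> in row 2 and its pairing.\<close>

lemma \<Delta>_bij:
  assumes I: "I = {1..K}" and R: "card R = R1" and s: "(\<Sum>j\<in>I. w j) = s"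
  shows "bij_betw (\<lambda>(S, \<sigma>). (perm_array S \<sigma>, \<phi>))
    (SIGMA S:{S. S \<subseteq> I \<and> card S = R2}. {\<sigma> \<in> row1_perms. row_forest S Map.empty (inv \<sigma>)})
    (\<Delta> K R1 R2 s w R \<phi>)" (is "bij_betw ?F ?P _")
  unfolding bij_betw_def
proof
  show "inj_on ?F ?P"
  proof (rule inj_onI)
    fix x y assume xy: "x \<in> ?P" "y \<in> ?P" "?F x = ?F y"
    obtain S \<sigma> S' \<sigma>' where x: "x = (S, \<sigma>)" and y: "y = (S', \<sigma>')" by (cases x; cases y)
    have \<sigma>: "\<sigma> permutes V" "\<sigma>' permutes V" using xy x y by (auto simp: row1_perms_def)
    have eq: "perm_array S \<sigma> = perm_array S' \<sigma>'" using xy x y by simp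
    have "S = S'" using arg_cong[OF eq, of "\<lambda>\<alpha>. marked \<alpha> Row2"] by simp
    moreover have pp: "perm_pairing \<sigma> = perm_pairing \<sigma>'" using arg_cong[OF eq, of pairing] by simp
    have "\<sigma> v = \<sigma>' v" for v
    proof (cases "v \<in> V")
      case True
      then show ?thesis using perm_pairing_mem[of v "\<sigma> v" \<sigma>] perm_pairing_mem[of v "\<sigma> v" \<sigma>'] pp by simp
    qed (use \<sigma> in \<open>simp add: permutes_not_in\<close>)
    ultimately show "x = y" using x y by auto
  qed
next
  show "?F ` ?P = \<Delta> K R1 R2 s w R \<phi>"
  proof
    show "?F ` ?P \<subseteq> \<Delta> K R1 R2 s w R \<phi>"
    proof
      fix x assume "x \<in> ?F ` ?P"
      then obtain S \<sigma> where x: "x = (perm_array S \<sigma>, \<phi>)" and S: "S \<subseteq> I" "card S = R2"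
        and \<sigma>: "\<sigma> permutes V" "row_forest R \<phi> \<sigma>" "row_forest S Map.empty (inv \<sigma>)"
        by (auto simp: row1_perms_def)
      let ?\<alpha> = "perm_array S \<sigma>"
      have rv: "row_vertices ?\<alpha> i = Pair i ` V" for i by (rule row_vertices_cell_count) simp
      have blocks: "\<exists>u\<in>Pair Row1 ` V. \<exists>v\<in>Pair Row2 ` V. B = {u, v}" if B: "B \<in> perm_pairing \<sigma>" for B
      proof -
        obtain v where "v \<in> V" "B = {(Row1, v), (Row2, \<sigma> v)}" using B by (auto simp: perm_pairing_def)
        moreover have "\<sigma> v \<in> V" using \<open>v \<in> V\<close> permutes_in_image[OF \<sigma>(1)] by simp
        ultimately show ?thesis by blast
      qed
      have "two_row_array K R1 R2 s ?\<alpha>"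
        unfolding two_row_array_def rv I[symmetric]
      proof (intro conjI allI)
        show "(\<Sum>j\<in>I. cnt ?\<alpha> i j) = s" for i
          unfolding s[symmetric] by (rule sum.cong) (simp_all add: cell_count_def)
        show "marked ?\<alpha> i \<subseteq> I" for i using S R_sub by (cases i) auto
        show "partition_on (Pair Row1 ` V \<union> Pair Row2 ` V) (pairing ?\<alpha>)"
          using perm_pairing_partition[OF \<sigma>(1)] by simp
        show "\<forall>B\<in>pairing ?\<alpha>. \<exists>u\<in>Pair Row1 ` V. \<exists>v\<in>Pair Row2 ` V. B = {u, v}"
          using blocks by simp
      qed (use S R in \<open>auto simp: cell_count_def\<close>)
      moreover have "arrow_fun K R \<phi>"
        unfolding arrow_fun_def using dom_sub arrow I by (auto simp: ran_def)
      moreover have "forest_condition ?\<alpha> \<phi>"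
        using forest_condition_iff[OF \<sigma>(1), of ?\<alpha> S] \<sigma>(2,3) by simp
      ultimately show "x \<in> \<Delta> K R1 R2 s w R \<phi>"
        unfolding x \<Delta>_def AR_def I[symmetric] by (simp add: cell_count_def)
    qed
    show "\<Delta> K R1 R2 s w R \<phi> \<subseteq> ?F ` ?P"
    proof
      fix x assume "x \<in> \<Delta> K R1 R2 s w R \<phi>"
      then obtain \<alpha> where x: "x = (\<alpha>, \<phi>)" and arr: "two_row_array K R1 R2 s \<alpha>"
        and fc: "forest_condition \<alpha> \<phi>" and m1: "marked \<alpha> Row1 = R"
        and c: "\<forall>j\<in>I. cnt \<alpha> Row1 j = w j \<and> cnt \<alpha> Row2 j = w j"
        unfolding \<Delta>_def AR_def I[symmetric] by blast
      note arr = arr[unfolded two_row_array_def, folded I]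
      define S where "S = marked \<alpha> Row2"
      have cnt: "cnt \<alpha> = cell_count"
      proof (intro ext)
        fix i j
        show "cnt \<alpha> i j = cell_count i j"
          using c arr by (cases i) (simp_all add: cell_count_def)
      qed
      have rv: "row_vertices \<alpha> i = Pair i ` V" for i by (rule row_vertices_cell_count[OF cnt])
      have part: "partition_on (Pair Row1 ` V \<union> Pair Row2 ` V) (pairing \<alpha>)"
        "\<And>B. B \<in> pairing \<alpha> \<Longrightarrow> \<exists>u\<in>Pair Row1 ` V. \<exists>v\<in>Pair Row2 ` V. B = {u, v}"
        using arr unfolding rv by blast+
      then obtain \<sigma> where \<sigma>: "\<sigma> permutes V" "pairing \<alpha> = perm_pairing \<sigma>"
        using pairing_is_perm by metis
      have forests: "row_forest R \<phi> \<sigma>" "row_forest S Map.empty (inv \<sigma>)"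
        using fc forest_condition_iff[OF \<sigma> cnt m1 refl] by (simp_all add: S_def)
      have "marked \<alpha> = case_row R S"
        by (rule ext) (auto simp: m1 S_def split: row.split)
      then have "\<alpha> = perm_array S \<sigma>"
        unfolding perm_array_def using cnt \<sigma>(2) by (cases \<alpha>) simp
      moreover have "S \<subseteq> I" "card S = R2" using arr by (simp_all add: S_def)
      ultimately show "x \<in> ?F ` ?P"
        unfolding x using \<sigma>(1) forests by (intro image_eqI[of _ _ "(S, \<sigma>)"]) (simp_all add: row1_perms_def)
    qed
  qed
qed

end

section \<open>From the count to the closed formula\<close>

lemma columns_of_admissible:
  assumes "admissible K R1 s w R \<phi>"
  shows "columns {1..K} w R \<phi>"
proof
  show "R \<subseteq> {1..K}" "dom \<phi> \<subseteq> {1..K} - R"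
    using assms by (auto simp: admissible_def substructure_def arrow_fun_def)
  fix j k assume jk: "\<phi> j = Some k"
  then have j: "j \<in> dom \<phi>" by blast
  have "k \<notin> R \<union> dom \<phi>" "1 \<le> w k"
    using assms j jk unfolding admissible_def irreducible_arrows_def by force+
  moreover have "k \<in> {1..K}"
    using assms ranI[of \<phi>, OF jk] by (auto simp: admissible_def substructure_def arrow_fun_def)
  ultimately show "k \<in> {1..K} \<and> k \<notin> R \<and> k \<notin> dom \<phi> \<and> 1 \<le> w k" by simp
qed simp

lemma inv_fact_diff: "n \<le> m \<Longrightarrow> inv_fact (int m - int n) = 1 / fact (m - n)"
  by (simp add: inv_fact_def flip: of_nat_diff)

lemma falling_fact_eq_inv_fact:
  assumes "A \<le> M"
  shows "real (\<Prod>{M - A + 1..M}) = fact M * inv_fact (int M - int A)"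
proof -
  have "(fact M :: nat) = \<Prod>{M - A + 1..M} * fact (M - A)"
    using fact_eq_fact_times[of "M - A" M] by (simp add: mult.commute)
  then have "(fact M :: real) = real (\<Prod>{M - A + 1..M}) * fact (M - A)"
    by (metis of_nat_fact of_nat_mult)
  then show ?thesis using inv_fact_diff[OF assms] by (simp add: field_simps)
qed

lemma binomial_eq_inv_fact:
  assumes "A < K" "1 \<le> k"
  shows "real ((K - A - 1) choose (k - 1)) =
    fact (K - A - 1) * inv_fact (int K - int k - int A) * inv_fact (int k - 1)"
proof (cases "k + A \<le> K")
  case True
  have "inv_fact (int K - int k - int A) = 1 / fact (K - A - k)"
    using inv_fact_diff[OF True] by (simp add: algebra_simps)
  moreover have "inv_fact (int k - 1) = 1 / fact (k - 1)"
    using inv_fact_diff[OF assms(2)] by simp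
  moreover have "K - A - 1 - (k - 1) = K - A - k" using assms by simp
  ultimately show ?thesis
    using binomial_fact[of "k - 1" "K - A - 1", where ?'a = real] True assms by simp
next
  \<comment> \<open>Now \<open>K - k - A\<close> is negative; the convention for
    \<open>inv_fact\<close> gives \<open>0\<close>, as does the binomial coefficient.\<close>
  case False
  then have "K - A - 1 < k - 1" using assms by simp
  then show ?thesis using False by (simp add: binomial_eq_0 inv_fact_def)
qed

theorem theorem4p5:
  fixes K s R1 R2 r M :: nat
    and w :: "nat \<Rightarrow> nat"
    and \<R>\<^sub>1 :: "nat set"
    and \<phi> :: "nat \<rightharpoonup> nat"
  assumes "K \<ge> 1" and "s \<ge> 1"
    and "1 \<le> R1" and "R1 \<le> K" and "1 \<le> R2" and "R2 \<le> K"
    and "admissible K R1 s w \<R>\<^sub>1 \<phi>"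
    and "r = (\<Sum>j\<in>\<R>\<^sub>1. w j)"
    and "M = num_critical K w \<R>\<^sub>1 \<phi>"
  shows "real (T K R1 R2 s w \<R>\<^sub>1 \<phi>) =
    real r * (\<Sum>A = 0..min s K - 1.
      fact M * fact (K - A - 1) * fact (s - A - 1)
      * inv_fact (int M - int A) * inv_fact (int K - int R2 - int A) * inv_fact (int R2 - 1))"
proof -
  interpret columns "{1..K}" w \<R>\<^sub>1 \<phi> by (rule columns_of_admissible[OF assms(7)])
  have card_R: "card \<R>\<^sub>1 = R1" and sum_w: "(\<Sum>j\<in>{1..K}. w j) = s"
    using assms(7) by (simp_all add: admissible_def substructure_def)
  have s: "card V = s" using card_V sum_w by simp
  have M: "card C = M" using num_critical_eq assms(9) by simp
  have r: "card root_vertices = r" using card_root_vertices assms(8) by simp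
  \<comment> \<open>Marked columns are not critical and there is at least one, so
    \<open>A \<le> M\<close> implies \<open>A < K\<close>, as the binomial identity
    requires.\<close>
  have MK: "M < K"
  proof -
    have "C \<subseteq> {1..K} - \<R>\<^sub>1" unfolding crit_cols_def by blast
    then have "M \<le> card ({1..K} - \<R>\<^sub>1)" using M card_mono[of "{1..K} - \<R>\<^sub>1" C] by simp
    also have "\<dots> = K - R1" using R_sub card_R by (simp add: card_Diff_subset finite_subset)
    finally show ?thesis using assms(3,4) by simp
  qed
  let ?t = "\<lambda>A. fact M * fact (K - A - 1) * fact (s - A - 1)
      * inv_fact (int M - int A) * inv_fact (int K - int R2 - int A) * inv_fact (int R2 - 1)"
  have T_eq: "T K R1 R2 s w \<R>\<^sub>1 \<phi> = r * (\<Sum>A\<le>M. \<Prod>{M - A + 1..M} * ((K - A - 1) choose (R2 - 1)) * fact (s - A - 1))"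
  proof -
    have "V \<noteq> {}" using s assms(2) by auto
    then show ?thesis
      using bij_betw_same_card[OF \<Delta>_bij[OF refl card_R sum_w, of R2]] card_pairs[of R2] assms(5)
      unfolding T_def s M r by simp
  qed
  have "real (T K R1 R2 s w \<R>\<^sub>1 \<phi>) = real r * (\<Sum>A\<le>M. ?t A)"
  proof -
    have summand: "real (\<Prod>{M - A + 1..M} * ((K - A - 1) choose (R2 - 1)) * fact (s - A - 1)) = ?t A"
      if "A \<le> M" for A
      unfolding of_nat_mult of_nat_fact falling_fact_eq_inv_fact[OF that]
        binomial_eq_inv_fact[OF le_less_trans[OF that MK] assms(5)]
      by (simp add: mult_ac)
    have "real (\<Sum>A\<le>M. \<Prod>{M - A + 1..M} * ((K - A - 1) choose (R2 - 1)) * fact (s - A - 1))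
        = (\<Sum>A\<le>M. ?t A)"
      unfolding of_nat_sum by (rule sum.cong[OF refl]) (rule summand, erule atMost_iff[THEN iffD1])
    then show ?thesis unfolding T_eq by (subst of_nat_mult) (rule arg_cong)
  qed
  \<comment> \<open>For \<open>r = 0\<close> both sides are \<open>0\<close>. Otherwise a root
    vertex exists and is not critical, so \<open>M < s\<close> and the range of the sum contains all
    \<open>A \<le> M\<close>; the terms beyond \<open>M\<close> vanish because
    \<open>inv_fact\<close> of a negative number is \<open>0\<close>.\<close>
  also have "\<dots> = real r * (\<Sum>A = 0..min s K - 1. ?t A)"
  proof (cases "r = 0")
    case False
    have "M < s"
    proof -
      have "root_vertices \<noteq> {}" using False r card.empty by metis
      then obtain y where "y \<in> V" "blk (fst y) = None" by blast
      then have "X \<subset> V" using X_sub blk_X[of y] by auto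
      then have "card X < card V" by (rule psubset_card_mono[OF fin_V])
      then show ?thesis unfolding card_X M s .
    qed
    with MK have sub: "{..M} \<subseteq> {0..min s K - 1}" by auto
    have "(\<Sum>A\<le>M. ?t A) = (\<Sum>A = 0..min s K - 1. ?t A)"
    proof (rule sum.mono_neutral_left[OF _ sub])
      show "\<forall>A\<in>{0..min s K - 1} - {..M}. ?t A = 0"
      proof
        fix A assume "A \<in> {0..min s K - 1} - {..M}"
        then have "inv_fact (int M - int A) = 0" by (simp add: inv_fact_def)
        then show "?t A = 0" by (simp only: mult_zero_left mult_zero_right)
      qed
    qed simp
    then show ?thesis by (rule arg_cong)
  qed simp
  finally show ?thesis .
qed

end
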